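(* For all $B, D > 0$ there exist $K, \epsilon_0, R_0 > 0$ such that for all $R > R_0$ and $\epsilon < \epsilon_0$ the following holds. Let $(\gamma_i)_{i=0}^n$ be a linear sequence of geodesics in $\mathbb{H}^2 \subset \mathbb{H}^3$ and $(\gamma'_i)_{i=0}^n$ a semi-linear sequence of oriented geodesics in $\mathbb{H}^3$ which are $(R, B, \epsilon)$-well-matched. Then the map $e\colon \mathcal{F}(\gamma_0) \cup \mathcal{F}(\gamma_n) \to \mathcal{F}(\gamma'_0)\cup\mathcal{F}(\gamma'_n)$ has $K\epsilon$-bounded distortion at distance $D$.
   Context: Frames: $\mathcal{F}\mathbb{H}^3$ is the bundle of positively oriented orthonormal 3-frames. Fixing a base frame identifies $\mathcal{F}\mathbb{H}^3$ with the group $G$ of orientation-preserving isometries of $\mathbb{H}^3$; for frames $u,v$ let $u\to v = u^{-1}v\in G$ (so $u\cdot(u\to v)=v$). Fix a left-invariant Riemannian metric $d$ on $G$, write $d(g)=d(1,g)$ and $d(u,v) = d(u\to v)$. For an oriented geodesic $\gamma$ and a unit normal $v$ to $\gamma$, the associated frame is $(q,w,v)$ where $w$ is the positive unit tangent to $\gamma$ and $q$ completes $(w,v)$ to a positive frame; $\mathcal{F}(\gamma)$ is the set of all such frames. A map $\tilde e\colon X\to\mathcal{F}\mathbb{H}^3$ ($X\subset\mathcal{F}\mathbb{H}^3$) has $\epsilon$-bounded distortion to distance $D$ if $d(u\to v,\tilde e(u)\to\tilde e(v))<\epsilon$ whenever $u,v\in X$ and $d(u,v)<D$. Linear sequence: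 $(\gamma_i)$ pairwise disjoint geodesics in $\mathbb{H}^2$ with consecutive common orthogonals, each separating its predecessors from its successors, each oriented so that its successors lie to its left. Semi-linear sequence: oriented geodesics $(\gamma'_i)$ in $\mathbb{H}^3$ with each consecutive pair disjoint with a common orthogonal. Let $\eta_i$ (resp. $\eta'_i$) be the common orthogonal of $\gamma_i,\gamma_{i+1}$ (resp. $\gamma'_i,\gamma'_{i+1}$); $u_i$ (resp. $u'_i$) the complex distance between $\gamma_i$ and $\gamma_{i+1}$ (length of the orthogonal plus $i$ times the twist angle; $u_i$ is real positive); $v_i$ (resp. $v'_i$) the complex distance along $\gamma_i$ (resp. $\gamma'_i$) from $\eta_{i-1}$ to $\eta_i$ (signed translation plus $i$ times rotation; $v_i$ is real). The map $e$ is defined on $\mathcal{F}(\gamma_0)$ as the restriction of the orientation-preserving isometry of $\mathbb{H}^3$ taking oriented $\gamma_0$ to oriented $\gamma'_0$ and the inward unit tangent of $\eta_0$ at $\gamma_0$ to that of $\eta'_0$ at $\gamma'_0$, and on $\mathcal{F}(\gamma_n)$ likewise using the feet of $\eta_{n-1}$ and $\eta'_{n-1}$ on $\gamma_n$, $\gamma'_n$. The sequences are $(R,B,\epsilon)$-well-matched if for every index $i$ for which the quantities are defined: $v_i = 1$; $|v'_i - v_i| < \epsilon/R$; $B^{-1} < u_i e^{R/2} < B$; and $|u'_i - u_i| < \epsilon |u_i|$. *)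

theory Defs
  imports "HOL-Analysis.Analysis"
begin

(* ---------- Model: Isom^+(H^3) = PSL(2,C); frames = elements of SL(2,C) taken up to sign ----------
   Upper half-space model, boundary = complex option (None = infinity).
   Base frame at the point j: w0 = unit tangent of the geodesic from 0 to infinity (pointing to infinity),
   v0 = unit tangent of the geodesic from -1 to 1 (pointing to 1), q0 completing to a positive frame.
   A matrix A (det A = 1) represents the frame A . (q0,w0,v0); A and -A give the same frame. *)

type_synonym mat2 = "complex^2^2"

definition mk2 :: "complex \<Rightarrow> complex \<Rightarrow> complex \<Rightarrow> complex \<Rightarrow> mat2" where
  "mk2 a b c d = (\<chi> i j. if i = 1 then (if j = 1 then a else b) else (if j = 1 then c else d))"

definition sl2 :: "mat2 set" where
  "sl2 = {A. det A = 1}"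

definition minv :: "mat2 \<Rightarrow> mat2" where
  "minv A = mk2 (A$2$2) (- A$1$2) (- A$2$1) (A$1$1)"

definition mob :: "mat2 \<Rightarrow> complex option \<Rightarrow> complex option" where
  "mob A z = (case z of
      None \<Rightarrow> (if A$2$1 = 0 then None else Some (A$1$1 / A$2$1))
    | Some x \<Rightarrow> (if A$2$1 * x + A$2$2 = 0 then None
                 else Some ((A$1$1 * x + A$1$2) / (A$2$1 * x + A$2$2))))"

(* oriented geodesic of H^3 = (negative endpoint, positive endpoint) *)
type_synonym geod3 = "complex option \<times> complex option"

(* F(gamma): frames (q,w,v) with w the positive unit tangent of gamma *)
definition Fr :: "geod3 \<Rightarrow> mat2 set" where
  "Fr \<gamma> = {A. det A = 1 \<and> mob A (Some 0) = fst \<gamma> \<and> mob A None = snd \<gamma>}"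

(* right multiplication by Tr z: move a frame along its geodesic by complex distance z *)
definition Tr :: "complex \<Rightarrow> mat2" where
  "Tr z = mk2 (exp (z/2)) 0 0 (exp (- z/2))"

(* right multiplication by Nm z: move a frame along the geodesic in its normal direction v
   by complex distance z (translation Re z, rotation Im z about that geodesic) *)
definition Nm :: "complex \<Rightarrow> mat2" where
  "Nm z = mk2 (cosh (z/2)) (sinh (z/2)) (sinh (z/2)) (cosh (z/2))"

definition sl2_alg :: "mat2 set" where
  "sl2_alg = {X. X$1$1 + X$2$2 = 0}"

(* a (real) inner product on the Lie algebra; it determines a left-invariant Riemannian metric *)
definition lie_inner :: "(mat2 \<Rightarrow> mat2 \<Rightarrow> real) \<Rightarrow> bool" where
  "lie_inner Q \<longleftrightarrow>
     (\<forall>X Y. Q X Y = Q Y X) \<and>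
     (\<forall>X Y Z. Q (X + Y) Z = Q X Z + Q Y Z) \<and>
     (\<forall>(r::real) X Y. Q (r *\<^sub>R X) Y = r * Q X Y) \<and>
     (\<forall>X\<in>sl2_alg. X \<noteq> 0 \<longrightarrow> 0 < Q X X)"

definition adm_path :: "(real \<Rightarrow> mat2) \<Rightarrow> (real \<Rightarrow> mat2) \<Rightarrow> bool" where
  "adm_path c c' \<longleftrightarrow> continuous_on {0..1} c' \<and>
     (\<forall>t\<in>{0..1}. c t \<in> sl2 \<and> (c has_vector_derivative c' t) (at t within {0..1}))"

(* length w.r.t. the left-invariant metric: |c'(t)| = |c(t)^{-1} c'(t)|_Q *)
definition path_length :: "(mat2 \<Rightarrow> mat2 \<Rightarrow> real) \<Rightarrow> (real \<Rightarrow> mat2) \<Rightarrow> (real \<Rightarrow> mat2) \<Rightarrow> real" where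
  "path_length Q c c' = integral {0..1} (\<lambda>t. sqrt (Q (minv (c t) ** c' t) (minv (c t) ** c' t)))"

definition sl2_dist :: "(mat2 \<Rightarrow> mat2 \<Rightarrow> real) \<Rightarrow> mat2 \<Rightarrow> mat2 \<Rightarrow> real" where
  "sl2_dist Q g h = Inf {path_length Q c c' | c c'. adm_path c c' \<and> c 0 = g \<and> c 1 = h}"

(* induced Riemannian distance on PSL(2,C) = G *)
definition gdist :: "(mat2 \<Rightarrow> mat2 \<Rightarrow> real) \<Rightarrow> mat2 \<Rightarrow> mat2 \<Rightarrow> real" where
  "gdist Q g h = min (sl2_dist Q g h) (sl2_dist Q g (- h))"

definition bounded_distortion ::
  "(mat2 \<Rightarrow> mat2 \<Rightarrow> real) \<Rightarrow> real \<Rightarrow> real \<Rightarrow> mat2 set \<Rightarrow> (mat2 \<Rightarrow> mat2) \<Rightarrow> bool" where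
  "bounded_distortion Q \<delta> D X e \<longleftrightarrow>
     (\<forall>x\<in>X. \<forall>y\<in>X. gdist Q (mat 1) (minv x ** y) < D \<longrightarrow>
        gdist Q (minv x ** y) (minv (e x) ** e y) < \<delta>)"

(* ---------- Geodesics in H^2 (the vertical half-plane over the extended real line) ---------- *)

type_synonym geod2 = "real option \<times> real option"

definition cyc :: "real option \<Rightarrow> real option \<Rightarrow> real option \<Rightarrow> bool" where
  "cyc a b c = (case (a, b, c) of
      (Some x, Some y, Some z) \<Rightarrow> (x < y \<and> y < z) \<or> (y < z \<and> z < x) \<or> (z < x \<and> x < y)
    | (Some x, Some y, None) \<Rightarrow> x < y
    | (Some x, None, Some z) \<Rightarrow> z < x
    | (None, Some y, Some z) \<Rightarrow> y < z
    | _ \<Rightarrow> False)"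

definition geod_left :: "geod2 \<Rightarrow> geod2 \<Rightarrow> bool" where
  "geod_left g h \<longleftrightarrow> cyc (fst g) (snd g) (fst h) \<and> cyc (fst g) (snd g) (snd h)"

definition geod_right :: "geod2 \<Rightarrow> geod2 \<Rightarrow> bool" where
  "geod_right g h \<longleftrightarrow> cyc (snd g) (fst g) (fst h) \<and> cyc (snd g) (fst g) (snd h)"

(* linear sequence gamma_0..gamma_n: each gamma_i has its successors strictly to its left and its
   predecessors strictly to its right (this encodes pairwise disjointness, common orthogonals,
   separation and the orientation convention) *)
definition linear_seq :: "(nat \<Rightarrow> geod2) \<Rightarrow> nat \<Rightarrow> bool" where
  "linear_seq \<gamma> n \<longleftrightarrow> (\<forall>i\<le>n. fst (\<gamma> i) \<noteq> snd (\<gamma> i)) \<and>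
     (\<forall>i k. i < k \<and> k \<le> n \<longrightarrow> geod_left (\<gamma> i) (\<gamma> k) \<and> geod_right (\<gamma> k) (\<gamma> i))"

definition emb_geod :: "geod2 \<Rightarrow> geod3" where
  "emb_geod g = (map_option complex_of_real (fst g), map_option complex_of_real (snd g))"

(* A is the frame at the foot on g of the common orthogonal of g and h, with normal pointing along
   it towards h, and z (Re z > 0) is a complex distance from g to h *)
definition common_perp :: "geod3 \<Rightarrow> geod3 \<Rightarrow> mat2 \<Rightarrow> complex \<Rightarrow> bool" where
  "common_perp g h A z \<longleftrightarrow> A \<in> Fr g \<and> 0 < Re z \<and> A ** Nm z \<in> Fr h"

definition semi_linear_seq :: "(nat \<Rightarrow> geod3) \<Rightarrow> nat \<Rightarrow> bool" where
  "semi_linear_seq \<gamma> n \<longleftrightarrow> (\<forall>i\<le>n. fst (\<gamma> i) \<noteq> snd (\<gamma> i)) \<and>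
     (\<forall>i<n. \<exists>A z. common_perp (\<gamma> i) (\<gamma> (Suc i)) A z)"

(* A i: frame on gamma_i at the foot of eta_i pointing along eta_i (i < n);
   u i: complex distance between gamma_i and gamma_(i+1);
   v i: complex distance along gamma_i from eta_(i-1) to eta_i (0 < i < n).
   Complex distances are defined modulo 2 pi i; this fixes representatives. *)
definition frame_chain ::
  "(nat \<Rightarrow> geod3) \<Rightarrow> nat \<Rightarrow> (nat \<Rightarrow> mat2) \<Rightarrow> (nat \<Rightarrow> complex) \<Rightarrow> (nat \<Rightarrow> complex) \<Rightarrow> bool" where
  "frame_chain \<gamma> n A u v \<longleftrightarrow>
     (\<forall>i<n. common_perp (\<gamma> i) (\<gamma> (Suc i)) (A i) (u i)) \<and>
     (\<forall>i. 0 < i \<and> i < n \<longrightarrow> A i = A (i - 1) ** Nm (u (i - 1)) ** Tr (v i))"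

definition well_matched ::
  "real \<Rightarrow> real \<Rightarrow> real \<Rightarrow> nat \<Rightarrow> (nat \<Rightarrow> real) \<Rightarrow> (nat \<Rightarrow> real) \<Rightarrow> (nat \<Rightarrow> complex) \<Rightarrow> (nat \<Rightarrow> complex) \<Rightarrow> bool" where
  "well_matched R B \<epsilon> n u v u' v' \<longleftrightarrow>
     (\<forall>i. 0 < i \<and> i < n \<longrightarrow> v i = 1 \<and> cmod (v' i - complex_of_real (v i)) < \<epsilon> / R) \<and>
     (\<forall>i<n. 1 / B < u i * exp (R / 2) \<and> u i * exp (R / 2) < B \<and>
            cmod (u' i - complex_of_real (u i)) < \<epsilon> * \<bar>u i\<bar>)"

definition e_map :: "geod3 \<Rightarrow> mat2 \<Rightarrow> mat2 \<Rightarrow> mat2 \<Rightarrow> mat2 \<Rightarrow> mat2 \<Rightarrow> mat2" where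
  "e_map g0 A0 A0' Bn Bn' x = (if x \<in> Fr g0 then (A0' ** minv A0) ** x else (Bn' ** minv Bn) ** x)"

end

theory Submission
  imports Defs
begin

text \<open>Write the frames at the two ends as \<open>x = A\<^sub>0 diag(\<alpha>, \<alpha>\<^sup>-\<^sup>1)\<close> and \<open>y = A\<^sub>0 M diag(\<mu>, \<mu>\<^sup>-\<^sup>1)\<close> with
  \<open>M = N(u\<^sub>0) T(1) N(u\<^sub>1) \<dots> T(1) N(u\<^sub>m)\<close>; then every entry of \<open>x\<^sup>-\<^sup>1 y\<close> is a fixed multiple of the
  corresponding entry of \<open>M\<close>, and \<open>e\<close> just replaces \<open>M\<close> by \<open>M'\<close>. If \<open>d(x, y) < D\<close>, the matrix
  \<open>x\<^sup>-\<^sup>1 y\<close> is bounded, so it is enough that \<open>M'\<close> approximates \<open>M\<close> entrywise with relative error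
  \<open>O(\<epsilon>)\<close>. Boundedness of the product of the two off-diagonal entries also yields
  \<open>m \<le> R + O(1)\<close>. Each factor has relative error \<open>O(\<epsilon>/R)\<close> on the diagonal and \<open>O(\<epsilon>)\<close>
  off it, and the entries of \<open>M\<close> are positive, so
  \<open>|M' - M| \<le> O(\<epsilon>) M\<^sub>2\<close> entrywise, where \<open>M\<^sub>2\<close> is the same product with diagonal entries
  scaled by \<open>1 + 1/R\<close> and off-diagonal ones by 2. Since a further pair of off-diagonal factors costs
  \<open>u\<^sup>2 = O(exp (-R))\<close> and there are only about \<open>R\<close> factors, \<open>M\<^sub>2 \<le> O(1) M\<close> entrywise.\<close>

subsection \<open>Two by two matrices\<close>

lemma mk2_nth [simp]:
  "mk2 a b c d $ 1 $ 1 = a" "mk2 a b c d $ 1 $ 2 = b"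
  "mk2 a b c d $ 2 $ 1 = c" "mk2 a b c d $ 2 $ 2 = d"
  by (simp_all add: mk2_def)

lemma mat2_mult_nth:
  fixes A B :: "'a::semiring_1^2^2"
  shows "(A ** B) $ i $ j = A $ i $ 1 * B $ 1 $ j + A $ i $ 2 * B $ 2 $ j"
  by (simp add: matrix_matrix_mult_def sum_2)

lemma mat2_eq_iff:
  fixes A B :: "'a^2^2"
  shows "A = B \<longleftrightarrow> A$1$1 = B$1$1 \<and> A$1$2 = B$1$2 \<and> A$2$1 = B$2$1 \<and> A$2$2 = B$2$2"
  by (auto simp: vec_eq_iff forall_2)

lemma mat_1_nth2 [simp]:
  "(mat 1 :: 'a::semiring_1^2^2) $ 1 $ 1 = 1" "(mat 1 :: 'a::semiring_1^2^2) $ 1 $ 2 = 0"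
  "(mat 1 :: 'a::semiring_1^2^2) $ 2 $ 1 = 0" "(mat 1 :: 'a::semiring_1^2^2) $ 2 $ 2 = 1"
  by (simp_all add: mat_def)

lemma minv_nth [simp]:
  "minv A $ 1 $ 1 = A$2$2" "minv A $ 1 $ 2 = - A$1$2"
  "minv A $ 2 $ 1 = - A$2$1" "minv A $ 2 $ 2 = A$1$1"
  by (simp_all add: minv_def)

lemma sl2_iff: "A \<in> sl2 \<longleftrightarrow> A$1$1 * A$2$2 - A$1$2 * A$2$1 = 1"
  by (simp add: sl2_def det_2)

lemma minv_left: "A \<in> sl2 \<Longrightarrow> minv A ** A = mat 1"
  by (simp add: mat2_eq_iff mat2_mult_nth sl2_iff mult.commute)

lemma minv_right: "A \<in> sl2 \<Longrightarrow> A ** minv A = mat 1"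
  by (simp add: mat2_eq_iff mat2_mult_nth sl2_iff mult.commute)

lemma minv_mult: "minv (A ** B) = minv B ** minv A"
  by (simp add: mat2_eq_iff mat2_mult_nth algebra_simps)

lemma minv_minv: "minv (minv A) = A"
  by (simp add: mat2_eq_iff)

lemma minv_in_sl2: "A \<in> sl2 \<Longrightarrow> minv A \<in> sl2"
  by (simp add: sl2_iff mult.commute)

lemma mult_in_sl2: "A \<in> sl2 \<Longrightarrow> B \<in> sl2 \<Longrightarrow> A ** B \<in> sl2"
  by (simp add: sl2_def det_mul)

lemma uminus_in_sl2: "A \<in> sl2 \<Longrightarrow> - A \<in> sl2"
  by (simp add: sl2_iff)

lemma norm_mat2_le:
  fixes A :: mat2
  shows "norm A \<le> norm (A$1$1) + norm (A$1$2) + norm (A$2$1) + norm (A$2$2)"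
proof -
  have v: "norm x \<le> norm (x$1) + norm (x$2)" for x :: "'a::real_normed_vector^2"
    unfolding norm_vec_def using L2_set_le_sum[of UNIV "\<lambda>i. norm (x$i)"] by (simp add: sum_2)
  show ?thesis using v[of A] v[of "A$1"] v[of "A$2"] by linarith
qed

lemma norm_mat2_nth_le: "norm ((A::mat2) $ i $ j) \<le> norm A"
  using Finite_Cartesian_Product.norm_nth_le[of "A$i" j] Finite_Cartesian_Product.norm_nth_le[of A i]
  by linarith

lemma bounded_bilinear_mat2_mult:
  "bounded_bilinear ((**) :: mat2 \<Rightarrow> mat2 \<Rightarrow> mat2)"
  unfolding bilinear_conv_bounded_bilinear[symmetric] bilinear_def
  by (intro conjI allI linearI)
    (simp_all add: mat2_eq_iff mat2_mult_nth distrib_left distrib_right scaleR_add_right)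

lemma bounded_linear_minv: "bounded_linear minv"
  unfolding linear_conv_bounded_linear[symmetric]
  by (intro linearI) (simp_all add: mat2_eq_iff)

lemma mat2_mult_bound:
  obtains K where "K > 0" "\<And>(A::mat2) (B::mat2). norm (A ** B) \<le> K * norm A * norm B"
proof -
  obtain K where K: "K > 0" "\<forall>(A::mat2) (B::mat2). norm (A ** B) \<le> norm A * norm B * K"
    using bounded_bilinear.pos_bounded[OF bounded_bilinear_mat2_mult] by auto
  show ?thesis
  proof (rule that[OF K(1)])
    fix A B :: mat2
    have "norm (A ** B) \<le> norm A * norm B * K" using K(2) by (elim allE)
    also have "\<dots> = K * norm A * norm B" by simp
    finally show "norm (A ** B) \<le> K * norm A * norm B" .
  qed
qed

lemma norm_minv_le: "norm (minv A) \<le> 4 * norm A"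
  using norm_mat2_le[of "minv A"] norm_mat2_nth_le[of A 1 1] norm_mat2_nth_le[of A 1 2]
    norm_mat2_nth_le[of A 2 1] norm_mat2_nth_le[of A 2 2] by simp

subsection \<open>Left-invariant metrics on SL(2,C)\<close>

lemma lie_inner_bounded_bilinear:
  assumes "lie_inner Q" shows "bounded_bilinear Q"
proof -
  have 1: "Q X Y = Q Y X" "Q (X + Y) Z = Q X Z + Q Y Z" "Q (r *\<^sub>R X) Y = r * Q X Y" for X Y Z r
    using assms unfolding lie_inner_def by blast+
  have "Q X (Y + Z) = Q X Y + Q X Z" "Q X (r *\<^sub>R Y) = r * Q X Y" for X Y Z r
    using 1 by metis+
  then show ?thesis
    unfolding bilinear_conv_bounded_bilinear[symmetric] bilinear_def
    by (auto intro!: linearI simp: 1)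
qed

lemma lie_inner_upper:
  assumes "lie_inner Q"
  obtains K where "K > 0" "\<And>X. sqrt (Q X X) \<le> K * norm X"
proof -
  obtain K where K: "K > 0" "\<And>X Y. norm (Q X Y) \<le> norm X * norm Y * K"
    using bounded_bilinear.pos_bounded[OF lie_inner_bounded_bilinear[OF assms]] by blast
  have "sqrt (Q X X) \<le> sqrt K * norm X" for X
  proof -
    have "Q X X \<le> K * (norm X)^2" using K(2)[of X X] by (simp add: power2_eq_square algebra_simps abs_le_iff)
    from real_sqrt_le_mono[OF this] show ?thesis by (simp add: real_sqrt_mult)
  qed
  then show ?thesis using K(1) that[of "sqrt K"] by simp
qed

text \<open>By compactness: \<open>Q X X\<close> attains a minimum \<open>m > 0\<close> on the unit
  sphere of the traceless matrices, and homogeneity spreads this to all of them with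
  \<open>k = 1 / sqrt m\<close>. Positivity of \<open>Q\<close> is available only on traceless
  matrices.\<close>

lemma lie_inner_lower:
  assumes "lie_inner Q"
  obtains k where "k > 0" "\<And>X. X \<in> sl2_alg \<Longrightarrow> norm X \<le> k * sqrt (Q X X)"
proof -
  interpret Q: bounded_bilinear Q by (rule lie_inner_bounded_bilinear[OF assms])
  define S where "S = sphere (0::mat2) 1 \<inter> sl2_alg"
  have "closed sl2_alg" unfolding sl2_alg_def
    by (intro closed_Collect_eq continuous_intros)
  then have "compact S" unfolding S_def by (intro compact_Int_closed) auto
  moreover have "mk2 1 0 0 (-1) /\<^sub>R norm (mk2 1 0 0 (-1)) \<in> S"
    by (auto simp: S_def sl2_alg_def mat2_eq_iff)
  then have "S \<noteq> {}" by blast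
  moreover have "continuous_on S (\<lambda>X. Q X X)" by (intro Q.continuous_on continuous_intros)
  ultimately obtain X0 where X0: "X0 \<in> S" "\<And>X. X \<in> S \<Longrightarrow> Q X0 X0 \<le> Q X X"
    using continuous_attains_inf by (metis (no_types, lifting))
  define m where "m = Q X0 X0"
  have "X0 \<noteq> 0" "X0 \<in> sl2_alg" using X0(1) by (auto simp: S_def)
  then have m: "m > 0" using assms unfolding lie_inner_def m_def by blast
  have "norm X \<le> (1 / sqrt m) * sqrt (Q X X)" if "X \<in> sl2_alg" for X
  proof (cases "X = 0")
    case False
    have "X /\<^sub>R norm X \<in> S" using that False 
      by (auto simp: S_def sl2_alg_def simp flip: scaleR_add_right distrib_left)
    from X0(2)[OF this] have "m \<le> Q X X / (norm X)^2" 
      by (simp add: m_def Q.scaleR_left Q.scaleR_right power2_eq_square field_simps)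
    then have "m * (norm X)^2 \<le> Q X X" using False by (simp add: field_simps)
    from real_sqrt_le_mono[OF this] have "sqrt m * norm X \<le> sqrt (Q X X)" by (simp add: real_sqrt_mult)
    then show ?thesis using m by (simp add: field_simps)
  qed (simp add: Q.zero_left)
  then show ?thesis using m that[of "1 / sqrt m"] by simp
qed

text \<open>The determinant is constantly 1 along the path, and its derivative is the trace of
  \<open>minv (c t) ** c' t\<close>. This puts velocities where \<open>Q\<close> is positive
  definite.\<close>

lemma adm_path_velocity_in_alg:
  assumes "adm_path c c'" "t \<in> {0..1}"
  shows "minv (c t) ** c' t \<in> sl2_alg"
proof -
  have d: "(c has_vector_derivative c' t) (at t within {0..1})" and sl: "\<And>s. s \<in> {0..1} \<Longrightarrow> c s \<in> sl2"
    using assms by (auto simp: adm_path_def)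
  have e: "((\<lambda>s. c s $ i $ j) has_vector_derivative c' t $ i $ j) (at t within {0..1})" for i j
    using d by (intro bounded_linear.has_vector_derivative[OF bounded_linear_vec_nth]
                      bounded_linear.has_vector_derivative[OF bounded_linear_vec_nth])
  have d1: "((\<lambda>s. c s $ 1 $ 1 * c s $ 2 $ 2 - c s $ 1 $ 2 * c s $ 2 $ 1) has_vector_derivative
     (c t $ 1 $ 1 * c' t $ 2 $ 2 + c' t $ 1 $ 1 * c t $ 2 $ 2) -
     (c t $ 1 $ 2 * c' t $ 2 $ 1 + c' t $ 1 $ 2 * c t $ 2 $ 1)) (at t within {0..1})"
    by (intro has_vector_derivative_diff has_vector_derivative_mult e)
  have d2: "((\<lambda>s. c s $ 1 $ 1 * c s $ 2 $ 2 - c s $ 1 $ 2 * c s $ 2 $ 1) has_vector_derivative 0) (at t within {0..1})"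
    by (rule has_vector_derivative_transform[OF assms(2) _ has_vector_derivative_const[of 1]])
      (use sl in \<open>auto simp: sl2_iff\<close>)
  have "(c t $ 1 $ 1 * c' t $ 2 $ 2 + c' t $ 1 $ 1 * c t $ 2 $ 2) -
     (c t $ 1 $ 2 * c' t $ 2 $ 1 + c' t $ 1 $ 2 * c t $ 2 $ 1) = 0"
    by (rule vector_derivative_unique_within_closed_interval
        [of "0::real" 1 t, unfolded cbox_interval, OF _ assms(2) d1 d2]) simp
  then show ?thesis by (simp add: sl2_alg_def mat2_mult_nth algebra_simps)
qed

lemma adm_path_continuous: "adm_path c c' \<Longrightarrow> continuous_on {0..1} c"
  unfolding adm_path_def continuous_on_eq_continuous_within
  by (auto intro: has_vector_derivative_continuous)

lemma adm_path_speed_continuous: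
  assumes "lie_inner Q" "adm_path c c'"
  shows "continuous_on {0..1} (\<lambda>t. sqrt (Q (minv (c t) ** c' t) (minv (c t) ** c' t)))"
proof -
  interpret Q: bounded_bilinear Q by (rule lie_inner_bounded_bilinear[OF assms(1)])
  interpret m: bounded_bilinear "(**) :: mat2 \<Rightarrow> mat2 \<Rightarrow> mat2" by (rule bounded_bilinear_mat2_mult)
  have "continuous_on {0..1} c'" using assms(2) by (simp add: adm_path_def)
  then show ?thesis using adm_path_continuous[OF assms(2)]
    by (intro continuous_on_real_sqrt Q.continuous_on m.continuous_on
        bounded_linear.continuous_on[OF bounded_linear_minv])
qed

lemma lie_inner_nonneg: "lie_inner Q \<Longrightarrow> X \<in> sl2_alg \<Longrightarrow> 0 \<le> Q X X"
  using bounded_bilinear.zero_left[OF lie_inner_bounded_bilinear[of Q], of X]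
  unfolding lie_inner_def by (cases "X = 0") (auto intro: less_imp_le)

lemma path_length_nonneg:
  assumes "lie_inner Q" "adm_path c c'"
  shows "0 \<le> path_length Q c c'"
  unfolding path_length_def
  by (intro integral_nonneg integrable_continuous_real adm_path_speed_continuous assms
      real_sqrt_ge_zero lie_inner_nonneg[OF assms(1)] adm_path_velocity_in_alg)

lemma sl2_dist_le_path_length:
  assumes "lie_inner Q" "adm_path c c'" "c 0 = g" "c 1 = h"
  shows "sl2_dist Q g h \<le> path_length Q c c'"
  unfolding sl2_dist_def
  by (rule cInf_lower) (use assms path_length_nonneg in \<open>auto intro!: bdd_belowI[of _ 0]\<close>)

lemma sl2_dist_self_le:
  assumes "lie_inner Q" "g \<in> sl2"
  shows "sl2_dist Q g g \<le> 0"
proof -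
  interpret Q: bounded_bilinear Q by (rule lie_inner_bounded_bilinear[OF assms(1)])
  have "adm_path (\<lambda>_. g) (\<lambda>_. 0)" using assms by (simp add: adm_path_def)
  from sl2_dist_le_path_length[OF assms(1) this, of g g] show ?thesis
    by (simp add: path_length_def Q.zero_left)
qed

text \<open>A Gronwall argument: \<open>c'\<close> is \<open>c\<close> times its left-invariant
  velocity, whose norm is at most a constant times the speed, so \<open>norm (c t)\<close> grows at
  most exponentially in the length travelled.\<close>

lemma path_length_norm_bound:
  assumes "lie_inner Q"
  obtains K where "K > 0"
    "\<And>c c'. adm_path c c' \<Longrightarrow> c 0 = mat 1 \<Longrightarrow> norm (c 1) \<le> K * exp (K * path_length Q c c')"
proof -
  obtain k where k: "k > 0" "\<And>X. X \<in> sl2_alg \<Longrightarrow> norm X \<le> k * sqrt (Q X X)"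
    using lie_inner_lower[OF assms] by blast
  obtain m where m: "m > 0" "\<And>(A::mat2) (B::mat2). norm (A ** B) \<le> m * norm A * norm B"
    using mat2_mult_bound by blast
  define K where "K = m * k"
  have K: "K > 0" using k m by (simp add: K_def)
  have "norm (c 1) \<le> norm (mat 1 :: mat2) * exp (K * path_length Q c c')"
    if c: "adm_path c c'" "c 0 = mat 1" for c c'
  proof -
    define s where "s t = sqrt (Q (minv (c t) ** c' t) (minv (c t) ** c' t))" for t
    define L where "L t = integral {0..t} s" for t
    have scont: "continuous_on {0..1} s"
      unfolding s_def by (rule adm_path_speed_continuous[OF assms c(1)])
    have L: "(L has_real_derivative s t) (at t within {0..1})" if "t \<in> {0..1}" for t
      using integral_has_real_derivative[OF scont that] unfolding L_def .
    have d: "(c has_vector_derivative c' t) (at t within {0..1})" if "t \<in> {0..1}" for t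
      using c that by (simp add: adm_path_def)
    have d': "((\<lambda>t. inner (c t) (c t)) has_real_derivative 2 * inner (c t) (c' t)) (at t within {0..1})"
      if "t \<in> {0..1}" for t
      using bounded_bilinear.has_vector_derivative[OF bounded_bilinear_inner d[OF that] d[OF that]]
      by (simp add: inner_commute has_real_derivative_iff_has_vector_derivative)
    \<comment> \<open>The squared norm, discounted by the exponential growth allowed up to time t;
      the sign of its derivative is that of the bracket estimated in \<open>neg\<close>.\<close>
    define \<psi> where "\<psi> t = inner (c t) (c t) * exp (- 2 * K * L t)" for t
    have d\<psi>: "(\<psi> has_real_derivative 
        (2 * inner (c t) (c' t) - 2 * K * s t * inner (c t) (c t)) * exp (- 2 * K * L t)) (at t within {0..1})"
      if "t \<in> {0..1}" for t
      unfolding \<psi>_def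
      by (rule derivative_eq_intros d'[OF that] L[OF that] refl)+ (simp add: algebra_simps)
    have neg: "2 * inner (c t) (c' t) - 2 * K * s t * inner (c t) (c t) \<le> 0" if "t \<in> {0..1}" for t
    proof -
      have sl: "c t \<in> sl2" using c that by (simp add: adm_path_def)
      have e: "c' t = c t ** (minv (c t) ** c' t)"
        by (simp add: matrix_mul_assoc minv_right[OF sl])
      have "norm (minv (c t) ** c' t) \<le> k * s t"
        unfolding s_def by (intro k adm_path_velocity_in_alg[OF c(1) that])
      have "norm (c' t) \<le> m * norm (c t) * norm (minv (c t) ** c' t)"
        by (subst e) (rule m(2))
      also have "\<dots> \<le> m * norm (c t) * (k * s t)"
        using m(1) by (intro mult_left_mono \<open>norm (minv (c t) ** c' t) \<le> k * s t\<close>) auto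
      finally have n: "norm (c' t) \<le> K * s t * norm (c t)" by (simp add: K_def ac_simps)
      have "inner (c t) (c' t) \<le> norm (c t) * norm (c' t)" by (rule norm_cauchy_schwarz)
      also have "\<dots> \<le> norm (c t) * (K * s t * norm (c t))" by (intro mult_left_mono n) auto
      also have "\<dots> = K * s t * inner (c t) (c t)" 
        by (simp add: power2_norm_eq_inner[symmetric] power2_eq_square)
      finally show ?thesis by simp
    qed
    have "\<psi> 1 \<le> \<psi> 0"
    proof -
      define D\<psi> where "D\<psi> t = (2 * inner (c t) (c' t) - 2 * K * s t * inner (c t) (c t)) * exp (- 2 * K * L t)" for t
      have "(\<psi> has_derivative (*) (D\<psi> t)) (at t within {0..1})" if "t \<in> {0..1}" for t
        using d\<psi>[OF that] unfolding has_field_derivative_def D\<psi>_def .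
      then obtain x where "x \<in> {0<..<1}" "\<psi> 1 - \<psi> 0 = D\<psi> x * (1 - 0)"
        using mvt_simple[of "0::real" 1 \<psi> "\<lambda>t. (*) (D\<psi> t)"] by auto
      moreover have "D\<psi> x \<le> 0" using neg[of x] \<open>x \<in> {0<..<1}\<close> unfolding D\<psi>_def
        by (intro mult_nonpos_nonneg) auto
      ultimately show ?thesis by simp
    qed
    then have "inner (c 1) (c 1) \<le> inner (c 0) (c 0) * exp (2 * K * L 1)"
      by (simp add: \<psi>_def L_def exp_minus field_simps)
    also have "\<dots> = (norm (c 0) * exp (K * L 1))^2"
      by (simp add: power_mult_distrib power2_norm_eq_inner exp_double[symmetric] mult.assoc)
    finally have "(norm (c 1))^2 \<le> (norm (c 0) * exp (K * L 1))^2" by (simp add: power2_norm_eq_inner)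
    then have "norm (c 1) \<le> norm (c 0) * exp (K * L 1)" by (rule power2_le_imp_le) simp
    then show ?thesis unfolding L_def s_def path_length_def c(2) .
  qed
  note * = this
  \<comment> \<open>One constant serves both as prefactor and as rate; enlarging the rate is
    harmless because lengths are nonnegative.\<close>
  define K' where "K' = max K (norm (mat 1 :: mat2))"
  show ?thesis
  proof (rule that[of K'])
    show "K' > 0" using K by (simp add: K'_def)
    fix c c' assume c: "adm_path c c'" "c 0 = mat 1"
    have "norm (c 1) \<le> norm (mat 1 :: mat2) * exp (K * path_length Q c c')" by (rule *[OF c])
    also have "\<dots> \<le> K' * exp (K' * path_length Q c c')"
      using path_length_nonneg[OF assms c(1)] K
      by (intro mult_mono) (auto simp: K'_def intro!: mult_right_mono)
    finally show "norm (c 1) \<le> K' * exp (K' * path_length Q c c')" .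
  qed
qed

section \<open>Explicit paths from the identity, and comparison of the distance with the
  norm\<close>

lemma has_vector_derivative_mk2:
  assumes "(f1 has_vector_derivative d1) F" "(f2 has_vector_derivative d2) F"
    "(f3 has_vector_derivative d3) F" "(f4 has_vector_derivative d4) F"
  shows "((\<lambda>t. mk2 (f1 t) (f2 t) (f3 t) (f4 t)) has_vector_derivative mk2 d1 d2 d3 d4) F"
proof -
  have s: "mk2 a b c d = mk2 a 0 0 0 + mk2 0 b 0 0 + mk2 0 0 c 0 + mk2 0 0 0 d" for a b c d
    by (simp add: mat2_eq_iff)
  have l: "bounded_linear (\<lambda>a. mk2 a 0 0 0)" "bounded_linear (\<lambda>a. mk2 0 a 0 0)" 
    "bounded_linear (\<lambda>a. mk2 0 0 a 0)" "bounded_linear (\<lambda>a. mk2 0 0 0 a)" 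
    unfolding linear_conv_bounded_linear[symmetric]
    by (simp_all add: linear_iff mat2_eq_iff)
  show ?thesis
    by (subst s[of d1], subst s, intro has_vector_derivative_add l[THEN bounded_linear.has_vector_derivative] assms)
qed

lemma continuous_on_mk2:
  assumes "continuous_on S f1" "continuous_on S f2" "continuous_on S f3" "continuous_on S f4"
  shows "continuous_on S (\<lambda>t. mk2 (f1 t) (f2 t) (f3 t) (f4 t))"
proof -
  have "continuous_on S (\<lambda>t. if i = 1 then (if j = 1 then f1 t else f2 t) else (if j = 1 then f3 t else f4 t))"
    for i j :: 2
    using assms by (cases "i = 1"; cases "j = 1") simp_all
  then show ?thesis unfolding mk2_def by (intro continuous_on_vec_lambda)
qed

text \<open>The lower right entry is forced by the determinant. The path reaches \<open>g\<close> at time 1 only if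
  \<open>g$1$1 \<noteq> 0\<close>, since \<open>Ln 0\<close> is a junk value.\<close>

definition ln_path :: "mat2 \<Rightarrow> real \<Rightarrow> mat2" where
  "ln_path g t = mk2 (exp (of_real t * Ln (g$1$1))) (of_real t * g$1$2) (of_real t * g$2$1)
     ((1 + (of_real t)^2 * (g$1$2 * g$2$1)) * exp (- (of_real t * Ln (g$1$1))))"

definition ln_path_deriv :: "mat2 \<Rightarrow> real \<Rightarrow> mat2" where
  "ln_path_deriv g t = mk2 (Ln (g$1$1) * exp (of_real t * Ln (g$1$1))) (g$1$2) (g$2$1)
     ((2 * of_real t * (g$1$2 * g$2$1) - Ln (g$1$1) * (1 + (of_real t)^2 * (g$1$2 * g$2$1)))
       * exp (- (of_real t * Ln (g$1$1))))"

lemma adm_path_ln_path: "adm_path (ln_path g) (ln_path_deriv g)"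
  unfolding adm_path_def
proof (intro conjI ballI)
  show "continuous_on {0..1} (ln_path_deriv g)"
    unfolding ln_path_deriv_def by (intro continuous_on_mk2 continuous_intros)
next
  fix t :: real
  have "exp (complex_of_real t * Ln (g$1$1)) * exp (- (complex_of_real t * Ln (g$1$1))) = 1"
    by (simp flip: exp_add)
  then show "ln_path g t \<in> sl2"
    by (simp add: ln_path_def sl2_iff) (simp add: algebra_simps power2_eq_square)
  show "(ln_path g has_vector_derivative ln_path_deriv g t) (at t within {0..1})"
    unfolding ln_path_def ln_path_deriv_def
    by (intro has_vector_derivative_mk2; rule has_vector_derivative_real_field;
        (rule derivative_eq_intros refl | simp add: algebra_simps)+)
qed

lemma ln_path_0: "ln_path g 0 = mat 1"
  by (simp add: ln_path_def mat2_eq_iff)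

lemma ln_path_1:
  assumes "g \<in> sl2" "g$1$1 \<noteq> 0"
  shows "ln_path g 1 = g"
  using assms by (simp add: ln_path_def mat2_eq_iff exp_minus sl2_iff field_simps)

text \<open>Some admissible path from the identity to \<open>g\<close> is shorter than
  \<open>D\<close>, and its length controls the norm of its endpoint. The condition
  \<open>g$1$1 \<noteq> 0\<close> supplies the path \<open>ln_path g\<close>, so the infimum is not
  over the empty set.\<close>

lemma sl2_dist_norm_bound:
  assumes "lie_inner Q"
  obtains C where "C > 0"
    "\<And>g. g \<in> sl2 \<Longrightarrow> g$1$1 \<noteq> 0 \<Longrightarrow> sl2_dist Q (mat 1) g < D \<Longrightarrow> norm g \<le> C"
proof -
  obtain K where K: "K > 0"
    "\<And>c c'. adm_path c c' \<Longrightarrow> c 0 = mat 1 \<Longrightarrow> norm (c 1) \<le> K * exp (K * path_length Q c c')"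
    using path_length_norm_bound[OF assms] by blast
  have "norm g \<le> K * exp (K * D)" if g: "g \<in> sl2" "g$1$1 \<noteq> 0" "sl2_dist Q (mat 1) g < D" for g
  proof -
    have "{path_length Q c c' | c c'. adm_path c c' \<and> c 0 = mat 1 \<and> c 1 = g} \<noteq> {}"
      using adm_path_ln_path[of g] ln_path_0[of g] ln_path_1[OF g(1,2)] by blast
    then obtain c c' where c: "adm_path c c'" "c 0 = mat 1" "c 1 = g" "path_length Q c c' < D"
      using cInf_lessD[OF _ g(3)[unfolded sl2_dist_def]] by blast
    have "norm g \<le> K * exp (K * path_length Q c c')" using K(2)[OF c(1,2)] c(3) by simp
    also have "\<dots> \<le> K * exp (K * D)" using c(4) K(1) by simp
    finally show ?thesis .
  qed
  then show ?thesis using that[of "K * exp (K * D)"] K(1) by simp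
qed

text \<open>The minimum over the two signs is harmless: \<open>- g\<close> satisfies the same
  conditions and has the same norm.\<close>

lemma gdist_norm_bound:
  assumes "lie_inner Q"
  obtains C where "C > 0"
    "\<And>g. g \<in> sl2 \<Longrightarrow> g$1$1 \<noteq> 0 \<Longrightarrow> gdist Q (mat 1) g < D \<Longrightarrow> norm g \<le> C"
proof -
  obtain C where C: "C > 0"
    "\<And>g. g \<in> sl2 \<Longrightarrow> g$1$1 \<noteq> 0 \<Longrightarrow> sl2_dist Q (mat 1) g < D \<Longrightarrow> norm g \<le> C"
    using sl2_dist_norm_bound[OF assms, where D = D] by blast
  have "norm g \<le> C" if "g \<in> sl2" "g$1$1 \<noteq> 0" "gdist Q (mat 1) g < D" for g
    using that C(2)[of g] C(2)[of "- g"] uminus_in_sl2[of g] by (auto simp: gdist_def min_less_iff_disj)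
  then show ?thesis using that C(1) by blast
qed

lemma norm_exp_le_3: "norm z \<le> 1 \<Longrightarrow> norm (exp z) \<le> 3" for z :: complex
  using norm_exp[of z] exp_le by (smt (verit) exp_le_cancel_iff)

text \<open>Every term of the derivative contains \<open>Ln (g$1$1)\<close>, \<open>g$1$2\<close> or
  \<open>g$2$1\<close>, each at most twice \<open>norm (g - mat 1)\<close>, while the path itself
  stays bounded. The radius 1/2 is where \<open>norm (Ln (1 + z)) \<le> 2 * norm z\<close>
  holds.\<close>

lemma ln_path_velocity_bound:
  obtains K where "K > 0"
    "\<And>g t. norm (g - mat 1) < 1/2 \<Longrightarrow> t \<in> {0..1} \<Longrightarrow>
       norm (minv (ln_path g t) ** ln_path_deriv g t) \<le> K * norm (g - mat 1)"
proof -
  obtain m where m: "m > 0" "\<And>(A::mat2) (B::mat2). norm (A ** B) \<le> m * norm A * norm B"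
    using mat2_mult_bound by blast
  \<comment> \<open>The entries of the path are bounded by 3, 1, 1, 6, with sum 11, and
    \<open>minv\<close> costs a factor 4; those of the derivative are bounded by 6, 1, 1, 15 times
    \<open>norm (g - mat 1)\<close>, with sum 23.\<close>
  have "norm (minv (ln_path g t) ** ln_path_deriv g t) \<le> (m * 44 * 23) * norm (g - mat 1)"
    if g: "norm (g - mat 1) < 1/2" and t: "t \<in> {0..1}" for g t
  proof -
    define x where "x = norm (g - mat 1)"
    define L where "L = Ln (g$1$1)"
    define p where "p = g$1$2 * g$2$1"
    define w where "w = 1 + (complex_of_real t)^2 * p"
    have x: "0 \<le> x" "x < 1/2" using g by (auto simp: x_def)
    have n: "norm ((g - mat 1)$i$j) \<le> x" for i j unfolding x_def by (rule norm_mat2_nth_le)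
    have b: "norm (g$1$2) \<le> x" "norm (g$2$1) \<le> x" using n[of 1 2] n[of 2 1] by auto
    have "norm (g$1$1 - 1) \<le> x" using n[of 1 1] by simp
    then have L: "norm L \<le> 2 * x" using norm_Ln_le[of "g$1$1 - 1"] x by (simp add: L_def)
    have p: "norm p \<le> x * (1/2)" unfolding p_def norm_mult using b x by (intro mult_mono) auto
    have t2: "t^2 \<le> 1" using t by (simp add: power_le_one)
    have tp: "norm ((complex_of_real t)^2 * p) \<le> 1 * 1"
      unfolding norm_mult norm_power using t t2 p x by (intro mult_mono) auto
    have w: "norm w \<le> 2" unfolding w_def using norm_triangle_ineq[of 1 "(complex_of_real t)^2 * p"] tp by simp
    have tL: "norm (of_real t * L) \<le> 1"
      unfolding norm_mult using mult_mono[of "norm (of_real t::complex)" 1 "norm L" 1] t L x by auto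
    have e: "norm (exp (of_real t * L)) \<le> 3" "norm (exp (- (of_real t * L))) \<le> 3"
      using tL by (auto intro!: norm_exp_le_3 simp del: norm_exp_eq_Re)
    have tb: "norm (of_real t * z) \<le> norm z" for z :: complex
      using t by (simp add: norm_mult mult_left_le_one_le)
    have A: "norm (ln_path g t) \<le> 11"
    proof -
      have "norm (w * exp (- (of_real t * L))) \<le> 2 * 3"
        unfolding norm_mult using w e by (intro mult_mono) auto
      moreover have "norm (of_real t * g$1$2) \<le> 1" "norm (of_real t * g$2$1) \<le> 1"
        using tb[of "g$1$2"] tb[of "g$2$1"] b x by linarith+
      ultimately show ?thesis 
        using norm_mat2_le[of "ln_path g t"] e unfolding ln_path_def mk2_nth L_def p_def w_def by linarith
    qed
    have B: "norm (ln_path_deriv g t) \<le> 23 * x"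
    proof -
      have "norm (2 * of_real t * p) \<le> x" using tb[of p] p by (simp add: norm_mult)
      moreover have "norm (L * w) \<le> (2 * x) * 2" unfolding norm_mult using L w x by (intro mult_mono) auto
      ultimately have "norm (2 * of_real t * p - L * w) \<le> 5 * x"
        using norm_triangle_ineq4[of "2 * of_real t * p" "L * w"] by linarith
      then have "norm ((2 * of_real t * p - L * w) * exp (- (of_real t * L))) \<le> (5 * x) * 3"
        unfolding norm_mult[of "2 * of_real t * p - L * w"] using e x by (intro mult_mono) auto
      moreover have "norm (L * exp (of_real t * L)) \<le> (2 * x) * 3"
        unfolding norm_mult[of L] using e L x by (intro mult_mono) auto
      ultimately show ?thesis 
        using norm_mat2_le[of "ln_path_deriv g t"] b unfolding ln_path_deriv_def mk2_nth L_def p_def w_def by linarith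
    qed
    have "norm (minv (ln_path g t) ** ln_path_deriv g t) \<le> m * norm (minv (ln_path g t)) * norm (ln_path_deriv g t)"
      by (rule m)
    also have "\<dots> \<le> m * 44 * (23 * x)"
      using A B norm_minv_le[of "ln_path g t"] m(1) by (intro mult_mono) auto
    finally show ?thesis by (simp add: x_def)
  qed
  then show ?thesis using that[of "m * 44 * 23"] m(1) by simp
qed

text \<open>Left translation preserves speed. So \<open>ln_path\<close> from the identity to
  \<open>minv g ** h\<close>, moved by \<open>g\<close>, joins \<open>g\<close> to \<open>h\<close>,
  and its length is the integral of a speed at most proportional to
  \<open>norm (h - g)\<close>.\<close>

lemma sl2_dist_le_norm:
  assumes "lie_inner Q" "C > 0"
  obtains K \<delta> where "K > 0" "\<delta> > 0"
    "\<And>g h. g \<in> sl2 \<Longrightarrow> h \<in> sl2 \<Longrightarrow> norm g \<le> C \<Longrightarrow> norm (h - g) < \<delta> \<Longrightarrow> sl2_dist Q g h \<le> K * norm (h - g)"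
proof -
  obtain m where m: "m > 0" "\<And>(A::mat2) (B::mat2). norm (A ** B) \<le> m * norm A * norm B"
    using mat2_mult_bound by blast
  obtain l where l: "l > 0" "\<And>g t. norm (g - mat 1) < 1/2 \<Longrightarrow> t \<in> {0..1} \<Longrightarrow>
       norm (minv (ln_path g t) ** ln_path_deriv g t) \<le> l * norm (g - mat 1)"
    using ln_path_velocity_bound by blast
  obtain q where q: "q > 0" "\<And>X. sqrt (Q X X) \<le> q * norm X" using lie_inner_upper[OF assms(1)] by blast
  \<comment> \<open>\<open>M * norm (h - g)\<close> bounds the distance in norm of
    \<open>minv g ** h\<close> from the identity. The radius \<open>1 / (2 * M)\<close> keeps this
    below 1/2, which also makes the upper left entry nonzero.\<close>
  define M where "M = m * (4 * C)"
  have M: "M > 0" using m assms by (simp add: M_def)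
  have "sl2_dist Q g h \<le> (q * (l * M)) * norm (h - g)" 
    if gh: "g \<in> sl2" "h \<in> sl2" "norm g \<le> C" "norm (h - g) < 1 / (2 * M)" for g h
  proof -
    define k where "k = minv g ** h"
    have k: "k \<in> sl2" unfolding k_def by (intro mult_in_sl2 minv_in_sl2 gh)
    have "k - mat 1 = minv g ** (h - g)"
      using minv_left[OF gh(1)] by (simp add: k_def mat2_eq_iff mat2_mult_nth algebra_simps)
    then have "norm (k - mat 1) \<le> m * norm (minv g) * norm (h - g)" using m(2) by simp
    also have "\<dots> \<le> M * norm (h - g)" 
      unfolding M_def using norm_minv_le[of g] gh(3) m(1) by (intro mult_right_mono mult_left_mono) auto
    finally have n1: "norm (k - mat 1) \<le> M * norm (h - g)" .
    also have "\<dots> < 1/2" using gh(4) M by (simp add: field_simps)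
    finally have n2: "norm (k - mat 1) < 1/2" .
    have "norm (k$1$1 - 1) < 1/2" using norm_mat2_nth_le[of "k - mat 1" 1 1] n2 by simp
    then have k1: "k$1$1 \<noteq> 0" by auto
    interpret mm: bounded_bilinear "(**) :: mat2 \<Rightarrow> mat2 \<Rightarrow> mat2" by (rule bounded_bilinear_mat2_mult)
    have a: "adm_path (\<lambda>t. g ** ln_path k t) (\<lambda>t. g ** ln_path_deriv k t)"
      using adm_path_ln_path[of k] gh(1) unfolding adm_path_def
      by (auto intro!: mult_in_sl2 mm.continuous_on continuous_intros 
            bounded_linear.has_vector_derivative[OF mm.bounded_linear_right])
    have gk: "g ** k = h" by (simp add: k_def matrix_mul_assoc minv_right[OF gh(1)])
    have eq: "minv (g ** ln_path k t) ** (g ** ln_path_deriv k t) = minv (ln_path k t) ** ln_path_deriv k t" for t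
      by (metis minv_mult matrix_mul_assoc minv_left[OF gh(1)] matrix_mul_lid)
    have "sl2_dist Q g h \<le> path_length Q (\<lambda>t. g ** ln_path k t) (\<lambda>t. g ** ln_path_deriv k t)"
      by (rule sl2_dist_le_path_length[OF assms(1) a]) (simp_all add: ln_path_0 ln_path_1[OF k k1] gk)
    also have "\<dots> \<le> integral {0..1} (\<lambda>t::real. q * (l * (M * norm (h - g))))"
      unfolding path_length_def
    proof (rule integral_le)
      fix t :: real assume t: "t \<in> {0..1}"
      let ?X = "minv (ln_path k t) ** ln_path_deriv k t"
      have "sqrt (Q ?X ?X) \<le> q * norm ?X" by (rule q)
      also have "\<dots> \<le> q * (l * norm (k - mat 1))" using l(2)[OF n2 t] q(1) by simp
      also have "\<dots> \<le> q * (l * (M * norm (h - g)))" using n1 q(1) l(1) by simp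
      finally show "sqrt (Q (minv (g ** ln_path k t) ** (g ** ln_path_deriv k t)) (minv (g ** ln_path k t) ** (g ** ln_path_deriv k t)))
        \<le> q * (l * (M * norm (h - g)))" unfolding eq .
    qed (auto intro!: integrable_continuous_real adm_path_speed_continuous[OF assms(1) a])
    also have "\<dots> = (q * (l * M)) * norm (h - g)" by simp
    finally show ?thesis .
  qed
  then show ?thesis using that[of "q * (l * M)" "1 / (2 * M)"] q l M by simp
qed

subsection \<open>Products of perturbed positive matrices\<close>

fun mchain :: "(nat \<Rightarrow> 'a::semiring_1^2^2) \<Rightarrow> nat \<Rightarrow> 'a^2^2" where
  "mchain P 0 = P 0"
| "mchain P (Suc k) = mchain P k ** P (Suc k)"

text \<open>Errors are measured against the gap to a majorant because gaps multiply well: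
  \<open>a2 * b2 - a * b = (a2 - a) * b2 + a * (b2 - b)\<close>, and \<open>a' * b' - a * b\<close>
  splits in the same way. The bound \<open>t \<le> 1\<close> yields
  \<open>cmod b' \<le> b2\<close>.\<close>

lemma perturb_mult:
  fixes a b a2 b2 t :: real and a' b' :: complex
  assumes "0 \<le> t" "t \<le> 1" "0 \<le> a" "a \<le> a2" "0 \<le> b" "b \<le> b2"
    and a: "cmod (a' - of_real a) \<le> t * (a2 - a)" and b: "cmod (b' - of_real b) \<le> t * (b2 - b)"
  shows "cmod (a' * b' - of_real (a * b)) \<le> t * (a2 * b2 - a * b)"
proof -
  have "cmod b' \<le> cmod (b' - of_real b) + b"
    using norm_triangle_ineq[of "b' - of_real b" "of_real b"] assms by simp
  also have "\<dots> \<le> 1 * (b2 - b) + b"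
    using b assms mult_right_mono[of t 1 "b2 - b"] by linarith
  finally have b2: "cmod b' \<le> b2" by simp
  have "a' * b' - of_real (a * b) = (a' - of_real a) * b' + of_real a * (b' - of_real b)"
    by (simp add: algebra_simps)
  then have "cmod (a' * b' - of_real (a * b)) \<le> cmod (a' - of_real a) * cmod b' + a * cmod (b' - of_real b)"
    using norm_triangle_ineq[of "(a' - of_real a) * b'" "of_real a * (b' - of_real b)"] assms(3)
    by (simp add: norm_mult)
  also have "\<dots> \<le> t * (a2 - a) * b2 + a * (t * (b2 - b))"
    using a b b2 assms by (intro add_mono mult_mono mult_left_mono) auto
  also have "\<dots> = t * (a2 * b2 - a * b)" by (simp add: algebra_simps)
  finally show ?thesis .
qed

text \<open>An entry of a product is a sum of two products; \<open>perturb_mult\<close> treats each,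
  and the gaps add up. The factor \<open>t\<close> does not grow with \<open>m\<close>: all
  accumulation is left to the majorant product.\<close>

lemma mchain_perturb:
  fixes P P2 :: "nat \<Rightarrow> real^2^2" and P' :: "nat \<Rightarrow> mat2"
  assumes t: "0 \<le> t" "t \<le> 1"
    and P: "\<And>k i j. k \<le> m \<Longrightarrow> 0 \<le> P k $ i $ j" "\<And>k i j. k \<le> m \<Longrightarrow> P k $ i $ j \<le> P2 k $ i $ j"
    and P': "\<And>k i j. k \<le> m \<Longrightarrow> cmod (P' k $ i $ j - of_real (P k $ i $ j)) \<le> t * (P2 k $ i $ j - P k $ i $ j)"
  shows "0 \<le> mchain P m $ i $ j" "mchain P m $ i $ j \<le> mchain P2 m $ i $ j"
    "cmod (mchain P' m $ i $ j - of_real (mchain P m $ i $ j)) \<le> t * (mchain P2 m $ i $ j - mchain P m $ i $ j)"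
proof -
  have "k \<le> m \<Longrightarrow> 0 \<le> mchain P k $ i $ j \<and> mchain P k $ i $ j \<le> mchain P2 k $ i $ j \<and>
    cmod (mchain P' k $ i $ j - of_real (mchain P k $ i $ j)) \<le> t * (mchain P2 k $ i $ j - mchain P k $ i $ j)" for k
  proof (induction k arbitrary: i j)
    case 0
    then show ?case using P P' by simp
  next
    case (Suc k)
    then have k: "k \<le> m" by simp
    note I = Suc.IH[OF k]
    have I1: "0 \<le> mchain P k $ i $ j" "mchain P k $ i $ j \<le> mchain P2 k $ i $ j"
      "0 \<le> mchain P2 k $ i $ j" for i j using I[of i j] by auto
    have P1: "0 \<le> P (Suc k) $ i $ j" "P (Suc k) $ i $ j \<le> P2 (Suc k) $ i $ j" for i j
      using P[OF Suc.prems] by auto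
    have *: "cmod (mchain P' k $ i $ l * P' (Suc k) $ l $ j - of_real (mchain P k $ i $ l * P (Suc k) $ l $ j))
       \<le> t * (mchain P2 k $ i $ l * P2 (Suc k) $ l $ j - mchain P k $ i $ l * P (Suc k) $ l $ j)" for l
      using I[of i l] P'[OF Suc.prems] P1 t by (intro perturb_mult) auto
    have "cmod (mchain P' (Suc k) $ i $ j - of_real (mchain P (Suc k) $ i $ j))
      \<le> cmod (mchain P' k $ i $ 1 * P' (Suc k) $ 1 $ j - of_real (mchain P k $ i $ 1 * P (Suc k) $ 1 $ j))
      + cmod (mchain P' k $ i $ 2 * P' (Suc k) $ 2 $ j - of_real (mchain P k $ i $ 2 * P (Suc k) $ 2 $ j))"
      by (rule order_trans[OF _ norm_triangle_ineq]) (simp add: mat2_mult_nth algebra_simps)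
    also have "\<dots> \<le> t * (mchain P2 (Suc k) $ i $ j - mchain P (Suc k) $ i $ j)"
      using *[of 1] *[of 2] by (simp add: mat2_mult_nth algebra_simps)
    finally show ?case using I1 P1
      by (auto simp: mat2_mult_nth intro!: add_mono mult_mono add_nonneg_nonneg mult_nonneg_nonneg)
  qed
  then show "0 \<le> mchain P m $ i $ j" "mchain P m $ i $ j \<le> mchain P2 m $ i $ j"
    "cmod (mchain P' m $ i $ j - of_real (mchain P m $ i $ j)) \<le> t * (mchain P2 m $ i $ j - mchain P m $ i $ j)"
    by auto
qed

text \<open>Each entry is a sum over index paths of nonnegative products, and one path is kept: stay
  at 1; leave 1 at the last factor; leave 2 at the first factor. The lower right entry has two
  competing paths, staying at 2 (\<open>1 / q ^ m\<close>) and passing through 1 in between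
  (\<open>l\<^sup>2 * q ^ m\<close>), and both bounds are used later.\<close>

lemma mchain_lower:
  fixes P :: "nat \<Rightarrow> real^2^2"
  assumes q: "0 < q" and l: "0 \<le> l" "l \<le> 1"
    and P0: "1 \<le> P 0 $ 1 $ 1" "l \<le> P 0 $ 1 $ 2" "l \<le> P 0 $ 2 $ 1" "1 \<le> P 0 $ 2 $ 2"
    and P: "\<And>k. 0 < k \<Longrightarrow> k \<le> m \<Longrightarrow> q \<le> P k $ 1 $ 1 \<and> l * q \<le> P k $ 1 $ 2 \<and> 0 \<le> P k $ 2 $ 1 \<and> 1 / q \<le> P k $ 2 $ 2"
  shows "q ^ m \<le> mchain P m $ 1 $ 1" "l * q ^ m \<le> mchain P m $ 1 $ 2" "l * q ^ m \<le> mchain P m $ 2 $ 1"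
    "1 / q ^ m \<le> mchain P m $ 2 $ 2" "l\<^sup>2 * q ^ m \<le> mchain P m $ 2 $ 2"
proof -
  have "k \<le> m \<Longrightarrow> q ^ k \<le> mchain P k $ 1 $ 1 \<and> l * q ^ k \<le> mchain P k $ 1 $ 2 \<and> l * q ^ k \<le> mchain P k $ 2 $ 1 \<and>
    1 / q ^ k \<le> mchain P k $ 2 $ 2 \<and> l\<^sup>2 * q ^ k \<le> mchain P k $ 2 $ 2" for k
  proof (induction k)
    case 0
    \<comment> \<open>A single factor leaves no room for a passage through 1, so the second lower
      right bound rests on \<open>l \<le> 1\<close>.\<close>
    have "l\<^sup>2 \<le> 1" using l by (simp add: power_le_one)
    then show ?case using P0 by simp
  next
    case (Suc k)
    define x where "x = q ^ k"
    have x: "x > 0" using q by (simp add: x_def)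
    have I: "x \<le> mchain P k $ 1 $ 1" "l * x \<le> mchain P k $ 1 $ 2" "l * x \<le> mchain P k $ 2 $ 1"
       "1 / x \<le> mchain P k $ 2 $ 2" using Suc by (auto simp: x_def)
    have nn: "0 \<le> l * x" "0 \<le> 1 / x" "0 \<le> l * q" "0 \<le> 1 / q" using l x q by auto
    have p: "q \<le> P (Suc k) $ 1 $ 1" "l * q \<le> P (Suc k) $ 1 $ 2" "0 \<le> P (Suc k) $ 2 $ 1" "1 / q \<le> P (Suc k) $ 2 $ 2"
      using P[of "Suc k"] Suc.prems by auto
    have e: "x * q + l * x * 0 \<le> mchain P (Suc k) $ 1 $ 1"
      "x * (l * q) + 0 * 0 \<le> mchain P (Suc k) $ 1 $ 2"
      "l * x * q + 0 * 0 \<le> mchain P (Suc k) $ 2 $ 1"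
      "0 * 0 + 1 / x * (1 / q) \<le> mchain P (Suc k) $ 2 $ 2"
      "l * x * (l * q) + 0 * 0 \<le> mchain P (Suc k) $ 2 $ 2"
      unfolding mchain.simps mat2_mult_nth using I p nn q x
      by (intro add_mono mult_mono; linarith)+
    show ?case using e by (simp add: x_def[symmetric] algebra_simps power2_eq_square)
  qed
  then show "q ^ m \<le> mchain P m $ 1 $ 1" "l * q ^ m \<le> mchain P m $ 1 $ 2" "l * q ^ m \<le> mchain P m $ 2 $ 1"
    "1 / q ^ m \<le> mchain P m $ 2 $ 2" "l\<^sup>2 * q ^ m \<le> mchain P m $ 2 $ 2" by auto
qed

text \<open>Relative to the growth \<open>q ^ m\<close>, each factor spent at index 2 costs
  \<open>1 / q\<^sup>2\<close>, so such stretches sum like a geometric series with constants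
  independent of \<open>m\<close>. A pair of off-diagonal factors costs
  \<open>S\<^sup>2 \<le> \<sigma>\<close>; together with the excess of the diagonal entries it is
  absorbed in growth by \<open>1 + 4 * \<sigma>\<close> per step. The two terms of the lower right
  bound mirror the two paths of \<open>mchain_lower\<close>.\<close>

lemma mchain_upper:
  fixes P :: "nat \<Rightarrow> real^2^2"
  assumes q: "1 \<le> q" "5/2 \<le> q\<^sup>2" and S: "0 \<le> S" "S\<^sup>2 \<le> \<sigma>" "\<sigma> \<le> 1/10"
    and nn: "\<And>k i j. k \<le> m \<Longrightarrow> 0 \<le> P k $ i $ j"
    and P0: "P 0 $ 1 $ 1 \<le> 1 + \<sigma>" "P 0 $ 1 $ 2 \<le> S" "P 0 $ 2 $ 1 \<le> S" "P 0 $ 2 $ 2 \<le> 1 + \<sigma>"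
    and P: "\<And>k. 0 < k \<Longrightarrow> k \<le> m \<Longrightarrow> P k $ 1 $ 1 \<le> q * (1 + \<sigma>) \<and> P k $ 1 $ 2 \<le> q * S \<and>
       P k $ 2 $ 1 \<le> S / q \<and> P k $ 2 $ 2 \<le> (1 + \<sigma>) / q"
  defines "T \<equiv> (1 + 4 * \<sigma>) ^ m"
  shows "mchain P m $ 1 $ 1 \<le> 2 * T * q ^ m" "mchain P m $ 1 $ 2 \<le> 4 * T * S * q ^ m"
    "mchain P m $ 2 $ 1 \<le> 4 * T * S * q ^ m" "mchain P m $ 2 $ 2 \<le> 2 * T * (1 / q ^ m + 4 * S\<^sup>2 * q ^ m)"
proof -
  have \<sigma>: "0 \<le> \<sigma>" using S(2) zero_le_power2[of S] by linarith
  define \<theta> where "\<theta> = 1 + 4 * \<sigma>"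
  have \<theta>: "\<theta> \<ge> 1" using \<sigma> by (simp add: \<theta>_def)
  define p where "p = 1 / q\<^sup>2"
  have "2 / 5 = 1 / (5/2 :: real)" by simp
  also have "\<dots> \<ge> p" unfolding p_def using q by (intro divide_left_mono) auto
  finally have p: "p \<le> 2/5" .
  have p0: "0 \<le> p" by (simp add: p_def)
  have pq: "z / q = p * q * z" for z using q by (simp add: p_def power2_eq_square)
  have sp: "(1 + \<sigma>) * p \<le> 11/10 * (2/5)" using \<sigma> S p p0 by (intro mult_mono) auto
  \<comment> \<open>The term \<open>- 1 / q ^ (2 * k)\<close> absorbs the geometric series that feeds the lower left entry.\<close>
  have "k \<le> m \<Longrightarrow> mchain P k $ 1 $ 1 \<le> \<theta> ^ k * q ^ k * 2 \<and> mchain P k $ 1 $ 2 \<le> \<theta> ^ k * q ^ k * (S * 4) \<and>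
    mchain P k $ 2 $ 1 \<le> \<theta> ^ k * q ^ k * (S * (2 * (2 - 1 / (q ^ k)\<^sup>2))) \<and>
    mchain P k $ 2 $ 2 \<le> \<theta> ^ k * q ^ k * (2 * (1 / (q ^ k)\<^sup>2 + 4 * S\<^sup>2))" for k
  proof (induction k)
    case 0
    have "P 0 $ 2 $ 2 \<le> 2 + 8 * S\<^sup>2" using P0 S zero_le_power2[of S] by linarith
    then show ?case using P0 S by auto
  next
    case (Suc k)
    define T x y where "T = \<theta> ^ k" and "x = q ^ k" and "y = 1 / x\<^sup>2"
    have T: "T \<ge> 1" using \<theta> by (simp add: T_def one_le_power)
    have x: "x \<ge> 1" using q by (simp add: x_def one_le_power)
    have y: "0 \<le> y" "y \<le> 1" using x by (auto simp: y_def)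
    define a b c d where "a = mchain P k $ 1 $ 1" and "b = mchain P k $ 1 $ 2"
      and "c = mchain P k $ 2 $ 1" and "d = mchain P k $ 2 $ 2"
    have I: "a \<le> T * x * 2" "b \<le> T * x * (S * 4)" "c \<le> T * x * (S * (2 * (2 - y)))" "d \<le> T * x * (2 * (y + 4 * S\<^sup>2))"
      using Suc by (auto simp: T_def x_def y_def a_def b_def c_def d_def)
    have c4: "c \<le> T * x * (S * 4)"
      by (rule order_trans[OF I(3)]) (use T x y S in \<open>intro mult_left_mono; simp\<close>)
    have p1: "P (Suc k) $ 1 $ 1 \<le> q * (1 + \<sigma>)" "P (Suc k) $ 1 $ 2 \<le> q * S"
      "P (Suc k) $ 2 $ 1 \<le> p * q * S" "P (Suc k) $ 2 $ 2 \<le> p * q * (1 + \<sigma>)"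
      using P[of "Suc k"] Suc.prems by (auto simp: pq mult_ac)
    have n1: "0 \<le> P (Suc k) $ i $ j" for i j using nn Suc.prems by simp
    have nT: "0 \<le> T * x" "0 \<le> T * x * q" using T x q by auto
    have r: "0 \<le> T * x * 2" "0 \<le> T * x * (S * 4)" "0 \<le> T * x * (S * (2 * (2 - y)))" "0 \<le> T * x * (2 * (y + 4 * S\<^sup>2))"
      using nT S y by auto
    have y': "1 / (q ^ Suc k)\<^sup>2 = y * p" by (simp add: y_def p_def x_def power_mult_distrib)
    have xx: "\<theta> ^ Suc k * q ^ Suc k = T * x * q * \<theta>" by (simp add: T_def x_def)
    have "a * P (Suc k) $ 1 $ 1 + b * P (Suc k) $ 2 $ 1 \<le> T * x * 2 * (q * (1 + \<sigma>)) + T * x * (S * 4) * (p * q * S)"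
      using I p1 n1 r by (intro add_mono mult_mono) auto
    also have "\<dots> = T * x * q * (2 * (1 + \<sigma>) + 4 * (S\<^sup>2 * p))" by (simp add: algebra_simps power2_eq_square)
    also have "\<dots> \<le> T * x * q * (\<theta> * 2)"
    proof (rule mult_left_mono[OF _ nT(2)])
      have "S\<^sup>2 * p \<le> \<sigma> * 1" using S p p0 \<sigma> by (intro mult_mono) auto
      moreover have "\<theta> * 2 = 2 + 8 * \<sigma>" "2 * (1 + \<sigma>) = 2 + 2 * \<sigma>" by (simp_all add: \<theta>_def)
      ultimately show "2 * (1 + \<sigma>) + 4 * (S\<^sup>2 * p) \<le> \<theta> * 2" using \<sigma> by linarith
    qed
    finally have A: "mchain P (Suc k) $ 1 $ 1 \<le> \<theta> ^ Suc k * q ^ Suc k * 2"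
      unfolding xx by (simp add: mat2_mult_nth a_def b_def mult.assoc)
    \<comment> \<open>Since \<open>(1 + \<sigma>) * p \<le> 11/25 < 1/2\<close>, the constant 4
      reproduces itself: 2 comes from the left column and less than 2 from the contracted old
      value.\<close>
    have g: "2 + 4 * ((1 + \<sigma>) * p) \<le> \<theta> * 4" using sp \<theta> by linarith
    have "a * P (Suc k) $ 1 $ 2 + b * P (Suc k) $ 2 $ 2 \<le> T * x * 2 * (q * S) + T * x * (S * 4) * (p * q * (1 + \<sigma>))"
      using I p1 n1 r by (intro add_mono mult_mono) auto
    also have "\<dots> = T * x * q * (S * (2 + 4 * ((1 + \<sigma>) * p)))" by (simp add: algebra_simps)
    also have "\<dots> \<le> T * x * q * (S * (\<theta> * 4))"
      using g S by (intro mult_left_mono nT) auto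
    finally have B: "mchain P (Suc k) $ 1 $ 2 \<le> \<theta> ^ Suc k * q ^ Suc k * (S * 4)"
      unfolding xx by (simp add: mat2_mult_nth a_def b_def mult_ac)
    have "c * P (Suc k) $ 1 $ 2 + d * P (Suc k) $ 2 $ 2 \<le> T * x * (S * 4) * (q * S) + T * x * (2 * (y + 4 * S\<^sup>2)) * (p * q * (1 + \<sigma>))"
      using I p1 n1 r c4 by (intro add_mono mult_mono) auto
    also have "\<dots> = T * x * q * (2 * (y * p * (1 + \<sigma>) + S\<^sup>2 * (2 + 4 * ((1 + \<sigma>) * p))))"
      by (simp add: algebra_simps power2_eq_square)
    also have "\<dots> \<le> T * x * q * (2 * (y * p * \<theta> + S\<^sup>2 * (\<theta> * 4)))"
      using g y p0 \<sigma> by (intro mult_left_mono add_mono nT) (auto simp: \<theta>_def)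
    finally have D: "mchain P (Suc k) $ 2 $ 2 \<le> \<theta> ^ Suc k * q ^ Suc k * (2 * (1 / (q ^ Suc k)\<^sup>2 + 4 * S\<^sup>2))"
      unfolding xx y' by (simp add: mat2_mult_nth c_def d_def algebra_simps)
    have "c * P (Suc k) $ 1 $ 1 + d * P (Suc k) $ 2 $ 1 \<le> 
        T * x * (S * (2 * (2 - y))) * (q * (1 + \<sigma>)) + T * x * (2 * (y + 4 * S\<^sup>2)) * (p * q * S)"
      using I p1 n1 r by (intro add_mono mult_mono) auto
    also have "\<dots> = T * x * q * (S * (2 * ((2 - y) * (1 + \<sigma>) + y * p + 4 * (S\<^sup>2 * p))))"
      by (simp add: algebra_simps power2_eq_square)
    also have "\<dots> \<le> T * x * q * (S * (2 * (\<theta> * (2 - y * p))))"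
    proof -
      have 1: "S\<^sup>2 * p \<le> \<sigma> * (2/5)" using S p p0 \<sigma> by (intro mult_mono) auto
      have 2: "y * p \<le> y * (2/5)" using p y by (intro mult_left_mono) auto
      have 3: "\<sigma> * (y * p) \<le> \<sigma> * (2/5)" using 2 y \<sigma> by (intro mult_left_mono) auto
      have 4: "0 \<le> \<sigma> * y" using \<sigma> y by simp
      have "(2 - y) * (1 + \<sigma>) + y * p + 4 * (S\<^sup>2 * p) = 2 + 2 * \<sigma> - y - \<sigma> * y + y * p + 4 * (S\<^sup>2 * p)"
        by (simp add: algebra_simps)
      also have "\<dots> \<le> 2 + 8 * \<sigma> - y * p - 4 * (\<sigma> * (y * p))" using 1 2 3 4 \<sigma> y by linarith
      also have "\<dots> = \<theta> * (2 - y * p)" by (simp add: \<theta>_def algebra_simps)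
      finally show ?thesis using S by (intro mult_left_mono nT) auto
    qed
    finally have C: "mchain P (Suc k) $ 2 $ 1 \<le> \<theta> ^ Suc k * q ^ Suc k * (S * (2 * (2 - 1 / (q ^ Suc k)\<^sup>2)))"
      unfolding xx y' by (simp add: mat2_mult_nth c_def d_def mult_ac)
    show ?case using A B C D by blast
  qed
  from this[of m] have F: "mchain P m $ 1 $ 1 \<le> T * q ^ m * 2" "mchain P m $ 1 $ 2 \<le> T * q ^ m * (S * 4)"
    "mchain P m $ 2 $ 1 \<le> T * q ^ m * (S * (2 * (2 - 1 / (q ^ m)\<^sup>2)))"
    "mchain P m $ 2 $ 2 \<le> T * q ^ m * (2 * (1 / (q ^ m)\<^sup>2 + 4 * S\<^sup>2))"
    unfolding T_def \<theta>_def by auto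
  have T: "T \<ge> 0" unfolding T_def using \<sigma> by simp
  show "mchain P m $ 1 $ 1 \<le> 2 * T * q ^ m" "mchain P m $ 1 $ 2 \<le> 4 * T * S * q ^ m" using F by (simp_all add: mult_ac)
  have "T * q ^ m * (S * (2 * (2 - 1 / (q ^ m)\<^sup>2))) \<le> T * q ^ m * (S * 4)"
    using T q S by (intro mult_left_mono) auto
  then show "mchain P m $ 2 $ 1 \<le> 4 * T * S * q ^ m" using F(3) by (simp add: mult_ac)
  have "T * q ^ m * (2 * (1 / (q ^ m)\<^sup>2 + 4 * S\<^sup>2)) = 2 * T * (1 / q ^ m + 4 * S\<^sup>2 * q ^ m)"
    using q by (simp add: field_simps power2_eq_square)
  with F(4) show "mchain P m $ 2 $ 2 \<le> 2 * T * (1 / q ^ m + 4 * S\<^sup>2 * q ^ m)" by linarith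
qed

subsection \<open>A single step of the chain\<close>

lemma norm_cosh_le_3: "norm z \<le> 1 \<Longrightarrow> norm (cosh z) \<le> 3" for z :: complex
  using norm_exp_le_3[of z] norm_exp_le_3[of "- z"] norm_triangle_ineq[of "exp z" "exp (- z)"]
  by (simp add: cosh_def del: norm_exp_eq_Re)

lemma norm_sinh_diff_le:
  fixes z w :: complex
  assumes "norm z \<le> 1" "norm w \<le> 1"
  shows "norm (sinh z - sinh w) \<le> 3 * norm (z - w)"
  by (rule field_differentiable_bound[of "cball 0 1" sinh cosh])
    (use assms in \<open>auto intro!: derivative_eq_intros norm_cosh_le_3\<close>)

text \<open>The derivative \<open>sinh\<close> is small near 0, which produces the extra factor
  \<open>r\<close>. Thus an error proportional to \<open>u\<close> in the argument gives an error of
  order \<open>u\<^sup>2\<close> in \<open>cosh\<close>; this is why diagonal errors are so much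
  smaller than off-diagonal ones.\<close>

lemma norm_cosh_diff_le:
  fixes z w :: complex
  assumes "norm z \<le> r" "norm w \<le> r" "r \<le> 1"
  shows "norm (cosh z - cosh w) \<le> 3 * r * norm (z - w)"
proof (rule field_differentiable_bound[of "cball 0 r" cosh sinh])
  show "norm (sinh x) \<le> 3 * r" if "x \<in> cball 0 r" for x :: complex
    using norm_sinh_diff_le[of x 0] that assms by simp
qed (use assms in \<open>auto intro!: derivative_eq_intros\<close>)

lemma norm_exp_diff_1_le:
  fixes z :: complex
  assumes "norm z \<le> 1"
  shows "norm (exp z - 1) \<le> 3 * norm z"
proof -
  have "norm (exp z - exp 0) \<le> 3 * norm (z - 0)"
    by (rule field_differentiable_bound[of "cball 0 1" exp exp])
      (use assms in \<open>auto intro!: derivative_eq_intros norm_exp_le_3 simp del: norm_exp_eq_Re\<close>)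
  then show ?thesis by simp
qed

lemma cosh_complex_of_real: "cosh (complex_of_real x) = of_real (cosh x)"
  by (simp add: cosh_def scaleR_conv_of_real exp_of_real[symmetric])

lemma sinh_complex_of_real: "sinh (complex_of_real x) = of_real (sinh x)"
  by (simp add: sinh_def scaleR_conv_of_real exp_of_real[symmetric])

lemma sinh_real_ge_self:
  fixes x :: real
  assumes "0 \<le> x"
  shows "x \<le> sinh x"
  using real_le_x_sinh[OF assms] by (simp add: sinh_def exp_minus)

lemma rel_error_mult:
  fixes x y \<alpha> \<beta> :: real and X Y :: complex
  assumes "0 \<le> x" "0 \<le> y" "0 \<le> \<alpha>" "0 \<le> \<beta>"
    and "cmod (X - of_real x) \<le> \<alpha> * x" "cmod (Y - of_real y) \<le> \<beta> * y"
  shows "cmod (X * Y - of_real (x * y)) \<le> (\<alpha> + \<beta> + \<alpha> * \<beta>) * (x * y)"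
proof -
  have "X * Y - of_real (x * y) = (X - of_real x) * (Y - of_real y) + of_real y * (X - of_real x) + of_real x * (Y - of_real y)"
    by (simp add: algebra_simps)
  then have "cmod (X * Y - of_real (x * y)) \<le> cmod (X - of_real x) * cmod (Y - of_real y) + y * cmod (X - of_real x) + x * cmod (Y - of_real y)"
    using norm_triangle_ineq[of "(X - of_real x) * (Y - of_real y) + of_real y * (X - of_real x)" "of_real x * (Y - of_real y)"]
      norm_triangle_ineq[of "(X - of_real x) * (Y - of_real y)" "of_real y * (X - of_real x)"] assms(1,2)
    by (simp add: norm_mult)
  also have "\<dots> \<le> (\<alpha> * x) * (\<beta> * y) + y * (\<alpha> * x) + x * (\<beta> * y)"
    using assms by (intro add_mono mult_mono) auto
  finally show ?thesis by (simp add: algebra_simps)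
qed

text \<open>For \<open>\<kappa> = \<tau> = 1\<close> this is \<open>Tr w ** Nm u\<close>; larger values of \<open>\<kappa>\<close> and \<open>\<tau>\<close> give the majorants of its
  perturbations.\<close>

definition rstep :: "real \<Rightarrow> real \<Rightarrow> real \<Rightarrow> real \<Rightarrow> real^2^2" where
  "rstep \<kappa> \<tau> w u = (\<chi> i j. exp (if i = 1 then w / 2 else - w / 2) *
     (if i = j then \<kappa> * cosh (u / 2) else \<tau> * sinh (u / 2)))"

lemma rstep_nth [simp]:
  "rstep \<kappa> \<tau> w u $ 1 $ 1 = exp (w / 2) * (\<kappa> * cosh (u / 2))"
  "rstep \<kappa> \<tau> w u $ 1 $ 2 = exp (w / 2) * (\<tau> * sinh (u / 2))"
  "rstep \<kappa> \<tau> w u $ 2 $ 1 = exp (- w / 2) * (\<tau> * sinh (u / 2))"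
  "rstep \<kappa> \<tau> w u $ 2 $ 2 = exp (- w / 2) * (\<kappa> * cosh (u / 2))"
  by (simp_all add: rstep_def)

lemma step_nth:
  "(Tr w ** Nm u) $ 1 $ 1 = exp (w / 2) * cosh (u / 2)"
  "(Tr w ** Nm u) $ 1 $ 2 = exp (w / 2) * sinh (u / 2)"
  "(Tr w ** Nm u) $ 2 $ 1 = exp (- w / 2) * sinh (u / 2)"
  "(Tr w ** Nm u) $ 2 $ 2 = exp (- w / 2) * cosh (u / 2)"
  by (simp_all add: mat2_mult_nth Tr_def Nm_def)

lemma Tr_Nm_of_real:
  "(Tr (of_real w) ** Nm (of_real u)) $ i $ j = of_real (rstep 1 1 w u $ i $ j)"
proof -
  have "\<forall>i j. (Tr (of_real w) ** Nm (of_real u)) $ i $ j = of_real (rstep 1 1 w u $ i $ j)"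
    unfolding forall_2 by (simp add: step_nth flip: cosh_complex_of_real sinh_complex_of_real exp_of_real)
  then show ?thesis by blast
qed

lemma cosh_half_le:
  fixes u :: real
  assumes "0 \<le> u" "u \<le> 1"
  shows "cosh (u / 2) \<le> 1 + u\<^sup>2"
proof -
  have "norm (cosh (complex_of_real (u/2)) - cosh 0) \<le> 3 * (u/2) * norm (complex_of_real (u/2) - 0)"
    by (rule norm_cosh_diff_le) (use assms in auto)
  also have "\<dots> = 3 / 4 * u\<^sup>2" using assms by (simp add: power2_eq_square)
  also have "cosh (complex_of_real (u/2)) - cosh 0 = of_real (cosh (u/2) - 1)"
    by (simp only: cosh_complex_of_real of_real_diff) simp
  finally have "cosh (u/2) - 1 \<le> 3 / 4 * u\<^sup>2" unfolding norm_of_real by linarith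
  then show ?thesis using zero_le_power2[of u] by linarith
qed

lemma sinh_half_bounds:
  fixes u :: real
  assumes "0 \<le> u" "u \<le> 1"
  shows "u / 2 \<le> sinh (u / 2)" "sinh (u / 2) \<le> 3 / 2 * u"
proof -
  show "u / 2 \<le> sinh (u / 2)" by (rule sinh_real_ge_self) (use assms in simp)
  have "norm (sinh (complex_of_real (u/2)) - sinh 0) \<le> 3 * norm (complex_of_real (u/2) - 0)"
    by (rule norm_sinh_diff_le) (use assms in auto)
  also have "sinh (complex_of_real (u/2)) - sinh 0 = of_real (sinh (u/2))"
    by (simp only: sinh_complex_of_real) simp
  finally show "sinh (u / 2) \<le> 3 / 2 * u" using assms by (simp only: norm_of_real) simp
qed

text \<open>The gap on the right is \<open>1 / R\<close> times the entry on the diagonal and the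
  entry itself off it. So the claim is a relative error of order \<open>\<epsilon> / R\<close> for
  \<open>cosh\<close>, where \<open>u\<^sup>2 \<le> 1 / R\<close> enters, and of order \<epsilon>
  for \<open>sinh\<close>; the exponential factor contributes order \<open>\<epsilon> / R\<close> to
  both.\<close>

lemma step_perturb:
  fixes u w R \<epsilon> :: real and u' w' :: complex
  assumes u: "0 < u" "u \<le> 1" "u\<^sup>2 \<le> 1 / R" and R: "1 \<le> R" and \<epsilon>: "0 < \<epsilon>" "\<epsilon> \<le> 1 / 11"
    and u': "cmod (u' - of_real u) \<le> \<epsilon> * u" and w': "cmod (w' - of_real w) \<le> \<epsilon> / R"
  shows "cmod ((Tr w' ** Nm u') $ i $ j - of_real (rstep 1 1 w u $ i $ j))
     \<le> 11 * \<epsilon> * (rstep (1 + 1 / R) 2 w u $ i $ j - rstep 1 1 w u $ i $ j)"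
proof -
  have eR: "\<epsilon> / R \<le> \<epsilon>" using R \<epsilon> by (simp add: field_simps)
  have eu: "\<epsilon> * u \<le> u / 11" using \<epsilon> u by (simp add: field_simps)
  have nu: "cmod (u' / 2 - of_real (u / 2)) \<le> \<epsilon> * u / 2"
  proof -
    have "u' / 2 - of_real (u / 2) = (u' - of_real u) / 2" by (simp add: field_simps)
    then have "cmod (u' / 2 - of_real (u / 2)) = cmod (u' - of_real u) / 2" by (simp only: norm_divide) simp
    then show ?thesis using u' by simp
  qed
  have nu2: "cmod (complex_of_real (u / 2)) = u / 2" using u unfolding norm_of_real by simp
  have "cmod (u' / 2) \<le> cmod (u' / 2 - of_real (u / 2)) + cmod (complex_of_real (u / 2))"
    using norm_triangle_ineq[of "u' / 2 - of_real (u / 2)" "of_real (u / 2)"] by simp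
  then have bu: "cmod (u' / 2) \<le> u" "cmod (complex_of_real (u / 2)) \<le> u"
    using nu nu2 eu u by linarith+
  have sh: "cmod (sinh (u' / 2) - of_real (sinh (u / 2))) \<le> (3 * \<epsilon>) * sinh (u / 2)"
  proof -
    have "cmod (sinh (u' / 2) - sinh (of_real (u / 2))) \<le> 3 * cmod (u' / 2 - of_real (u / 2))"
      using bu u by (intro norm_sinh_diff_le) linarith+
    also have "\<dots> \<le> 3 * \<epsilon> * (u / 2)" using nu by simp
    also have "\<dots> \<le> 3 * \<epsilon> * sinh (u / 2)" using sinh_half_bounds[of u] u \<epsilon> by (intro mult_left_mono) auto
    finally show ?thesis by (simp only: sinh_complex_of_real)
  qed
  have ch: "cmod (cosh (u' / 2) - of_real (cosh (u / 2))) \<le> (2 * \<epsilon> / R) * cosh (u / 2)"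
  proof -
    have "cmod (cosh (u' / 2) - cosh (of_real (u / 2))) \<le> 3 * u * cmod (u' / 2 - of_real (u / 2))"
      using bu u by (intro norm_cosh_diff_le) linarith+
    also have "\<dots> \<le> 3 * u * (\<epsilon> * u / 2)" using nu u by (intro mult_left_mono) auto
    also have "\<dots> \<le> 2 * \<epsilon> * u\<^sup>2" using \<epsilon> u by (simp add: power2_eq_square)
    also have "\<dots> \<le> 2 * \<epsilon> * (1 / R)" using \<epsilon> u by (intro mult_left_mono) auto
    also have "\<dots> \<le> 2 * \<epsilon> * (1 / R) * cosh (u / 2)" 
      using \<epsilon> R cosh_real_ge_1[of "u/2"] mult_left_mono[of 1 "cosh (u/2)" "2 * \<epsilon> * (1 / R)"] by simp
    finally show ?thesis unfolding cosh_complex_of_real by simp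
  qed
  \<comment> \<open>The sign \<open>s\<close> covers both rows, whose exponents are
    opposite.\<close>
  have ex: "cmod (exp (s * w' / 2) - of_real (exp (s * w / 2))) \<le> (2 * \<epsilon> / R) * exp (s * w / 2)" if "\<bar>s\<bar> = 1" for s :: real
  proof -
    define z where "z = s * (w' - of_real w) / 2"
    have z: "cmod z \<le> \<epsilon> / R / 2" using w' that by (simp add: z_def norm_divide norm_mult)
    have "exp (s * w' / 2) - of_real (exp (s * w / 2)) = of_real (exp (s * w / 2)) * (exp z - 1)"
      by (simp add: z_def exp_of_real[symmetric] exp_add[symmetric] algebra_simps flip: add_divide_distrib diff_divide_distrib)
    then have "cmod (exp (s * w' / 2) - of_real (exp (s * w / 2))) = exp (s * w / 2) * cmod (exp z - 1)"
      by (simp add: norm_mult)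
    also have "\<dots> \<le> exp (s * w / 2) * (3 * cmod z)"
      using z eR \<epsilon> by (intro mult_left_mono norm_exp_diff_1_le) auto
    also have "\<dots> \<le> exp (s * w / 2) * (2 * \<epsilon> / R)"
    proof (rule mult_left_mono)
      define \<delta> where "\<delta> = \<epsilon> / R"
      have "0 < \<delta>" using R \<epsilon> by (simp add: \<delta>_def)
      then have "3 * cmod z \<le> 2 * \<delta>" using z unfolding \<delta>_def[symmetric] by linarith
      then show "3 * cmod z \<le> 2 * \<epsilon> / R" by (simp add: \<delta>_def)
    qed simp
    finally show ?thesis by (simp add: mult_ac)
  qed
  have e1: "cmod (exp (w' / 2) - of_real (exp (w / 2))) \<le> (2 * \<epsilon> / R) * exp (w / 2)"
    and e2: "cmod (exp (- w' / 2) - of_real (exp (- w / 2))) \<le> (2 * \<epsilon> / R) * exp (- w / 2)"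
    using ex[of 1] ex[of "-1"] by simp_all
  have shp: "0 \<le> sinh (u / 2)" using u by simp
  have nn: "0 \<le> 2 * \<epsilon> / R" "0 \<le> 3 * \<epsilon>" using R \<epsilon> by auto
  \<comment> \<open>Each quadratic cross term is at most \<open>2 * \<epsilon> / R\<close>, so the
    totals are at most \<open>6 * \<epsilon> / R\<close> on the diagonal and
    \<open>7 * \<epsilon>\<close> off it; 11 covers both.\<close>
  have dc: "2 * \<epsilon> / R + 2 * \<epsilon> / R + 2 * \<epsilon> / R * (2 * \<epsilon> / R) \<le> 11 * \<epsilon> * (1 / R)"
  proof -
    have "2 * \<epsilon> / R * (2 * \<epsilon> / R) \<le> 2 * \<epsilon> / R * 1" using eR \<epsilon> nn by (intro mult_left_mono) auto
    then show ?thesis using nn by (simp add: field_simps)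
  qed
  have oc: "2 * \<epsilon> / R + 3 * \<epsilon> + 2 * \<epsilon> / R * (3 * \<epsilon>) \<le> 11 * \<epsilon>"
  proof -
    have "2 * \<epsilon> / R * (3 * \<epsilon>) \<le> 2 * \<epsilon> / R * 1" using \<epsilon> nn by (intro mult_left_mono) auto
    then show ?thesis using nn eR \<epsilon> by simp
  qed
  have D: "cmod (X * cosh (u' / 2) - of_real (x * cosh (u / 2))) \<le> 11 * \<epsilon> * (1 / R) * (x * cosh (u / 2))"
    if "0 \<le> x" "cmod (X - of_real x) \<le> (2 * \<epsilon> / R) * x" for x X
    by (rule order_trans[OF rel_error_mult[OF that(1) _ nn(1) nn(1) that(2) ch]], simp)
       (rule mult_right_mono[OF dc], use that in simp)
  have O: "cmod (X * sinh (u' / 2) - of_real (x * sinh (u / 2))) \<le> 11 * \<epsilon> * (x * sinh (u / 2))"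
    if "0 \<le> x" "cmod (X - of_real x) \<le> (2 * \<epsilon> / R) * x" for x X
    by (rule order_trans[OF rel_error_mult[OF that(1) shp nn that(2) sh]])
       (rule mult_right_mono[OF oc], use that shp in simp)
  have "\<forall>i j. cmod ((Tr w' ** Nm u') $ i $ j - of_real (rstep 1 1 w u $ i $ j))
     \<le> 11 * \<epsilon> * (rstep (1 + 1 / R) 2 w u $ i $ j - rstep 1 1 w u $ i $ j)"
    unfolding forall_2 step_nth rstep_nth
    using D[OF _ e1] D[OF _ e2] O[OF _ e1] O[OF _ e2] by (simp add: algebra_simps)
  then show ?thesis by blast
qed

subsection \<open>Relative error of the whole chain\<close>

text \<open>Along the initial geodesic there is no translation to record, so index 0 gets 0, which
  gives all factors the same shape. Multiplying \<open>A 0\<close> on the right by this product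
  leads to the frame at the last foot of the chain.\<close>

definition frame_product :: "(nat \<Rightarrow> complex) \<Rightarrow> (nat \<Rightarrow> complex) \<Rightarrow> nat \<Rightarrow> mat2" where
  "frame_product v u = mchain (\<lambda>k. Tr (if k = 0 then 0 else v k) ** Nm (u k))"

text \<open>The bound on the product of the off-diagonal entries is how closeness of the end frames
  enters: that product does not change when the frames slide along or rotate about their geodesics.
  It limits \<open>m\<close>, and then the majorant product exceeds the original one only by a
  constant factor.\<close>

lemma frame_product_relative_error:
  fixes B C :: real
  assumes B: "1 \<le> B" and C: "0 < C"
  obtains K where "K > 0"
    "\<And>R \<epsilon> m u u' v' i j. \<lbrakk>30 + 6 * B\<^sup>2 < R; 0 < \<epsilon>; \<epsilon> \<le> 1 / 11;
       \<And>k. k \<le> m \<Longrightarrow> 1 / B < u k * exp (R / 2) \<and> u k * exp (R / 2) < B \<and> cmod (u' k - of_real (u k)) \<le> \<epsilon> * u k;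
       \<And>k. 0 < k \<Longrightarrow> k \<le> m \<Longrightarrow> cmod (v' k - 1) \<le> \<epsilon> / R;
       cmod (frame_product (\<lambda>_. 1) (\<lambda>k. of_real (u k)) m $ 1 $ 2) *
         cmod (frame_product (\<lambda>_. 1) (\<lambda>k. of_real (u k)) m $ 2 $ 1) \<le> C\<rbrakk> \<Longrightarrow>
       cmod (frame_product v' u' m $ i $ j
         - frame_product (\<lambda>_. 1) (\<lambda>k. of_real (u k)) m $ i $ j)
       \<le> K * \<epsilon> * cmod (frame_product (\<lambda>_. 1) (\<lambda>k. of_real (u k)) m $ i $ j)"
proof -
  \<comment> \<open>\<open>Z\<close> will bound \<open>exp (real m - R)\<close>,
    \<open>\<Theta>\<close> then bounds \<open>(1 + 12 / R) ^ m\<close>, and \<open>\<kappa>\<close>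
    is the ratio of the upper bound for doubled off-diagonal entries to the lower bound for the
    original ones. \<open>K\<close> compares the results of \<open>mchain_upper\<close> and
    \<open>mchain_lower\<close>.\<close>
  define Z where "Z = max 1 (4 * B\<^sup>2 * C)"
  define \<Theta> where "\<Theta> = exp (12 * (1 + ln Z))"
  define \<kappa> where "\<kappa> = 6 * B\<^sup>2"
  define K where "K = 2 * \<Theta> * (1 + 4 * \<kappa>\<^sup>2)"
  have Z: "1 \<le> Z" by (simp add: Z_def)
  have \<kappa>: "1 \<le> \<kappa>" using one_le_power[OF B, of 2] by (simp add: \<kappa>_def)
  have K0: "K > 0" unfolding K_def \<Theta>_def by (intro mult_pos_pos add_pos_nonneg) auto
  have main: "cmod (M' $ i $ j - M $ i $ j) \<le> 11 * K * \<epsilon> * cmod (M $ i $ j)"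
    if R: "30 + 6 * B\<^sup>2 < R" and \<epsilon>: "0 < \<epsilon>" "\<epsilon> \<le> 1 / 11"
      and u: "\<And>k. k \<le> m \<Longrightarrow> 1 / B < u k * exp (R / 2) \<and> u k * exp (R / 2) < B \<and> cmod (u' k - of_real (u k)) \<le> \<epsilon> * u k"
      and v: "\<And>k. 0 < k \<Longrightarrow> k \<le> m \<Longrightarrow> cmod (v' k - 1) \<le> \<epsilon> / R"
      and M: "M = frame_product (\<lambda>_. 1) (\<lambda>k. of_real (u k)) m"
      and M': "M' = frame_product v' u' m"
      and bc: "cmod (M $ 1 $ 2) * cmod (M $ 2 $ 1) \<le> C"
    for R \<epsilon> :: real and m u u' v' M M' and i j :: 2
  proof -
    define E where "E = exp (- R / 2)"
    have E: "0 < E" "exp (R / 2) = 1 / E" by (auto simp: E_def exp_minus field_simps)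
    have E2: "E\<^sup>2 = exp (- R)" by (simp add: E_def power2_eq_square flip: exp_add)
    have R1: "1 \<le> R" "30 \<le> R" using R zero_le_power2[of B] by linarith+
    \<comment> \<open>The threshold for \<open>R\<close> comes from here:
      \<open>6 * B\<^sup>2 < R\<close> gives
      \<open>3 * B\<^sup>2 * R \<le> R\<^sup>2 / 2 \<le> exp R\<close>. Nine times the result is
      \<open>S\<^sup>2 \<le> \<sigma>\<close>, and the summand 30 gives
      \<open>\<sigma> \<le> 1/10\<close>.\<close>
    have BE: "B\<^sup>2 * E\<^sup>2 \<le> 1 / (3 * R)"
    proof -
      have "3 * B\<^sup>2 * R \<le> R / 2 * R" using R R1 by (intro mult_right_mono) auto
      also have "\<dots> \<le> exp R" using exp_lower_Taylor_quadratic[of R] R1 by (simp add: power2_eq_square)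
      finally show ?thesis using R1 by (simp add: E2 exp_minus field_simps)
    qed
    \<comment> \<open>With \<open>u\<close> between \<open>E / B\<close> and \<open>B * E\<close>,
      \<open>S\<close> bounds \<open>2 * sinh (u / 2)\<close> above and \<open>l\<close> bounds
      \<open>sinh (u / 2)\<close> below. The value \<open>3 / R\<close> dominates the excess of
      \<open>(1 + 1 / R) * (1 + 1 / R)\<close> over 1, and \<open>q\<close> is the expansion of a
      unit translation.\<close>
    define S l \<sigma> q where "S = 3 * B * E" and "l = E / (2 * B)" and "\<sigma> = 3 / R" and "q = exp (1 / 2 :: real)"
    have S2: "S\<^sup>2 \<le> \<sigma>" using BE R1 by (simp add: S_def \<sigma>_def power_mult_distrib field_simps)
    have S0: "0 \<le> S" using B E by (simp add: S_def)
    have Sl: "S = \<kappa> * l" using B by (simp add: S_def l_def \<kappa>_def power2_eq_square)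
    have \<sigma>: "\<sigma> \<le> 1 / 10" using R1 by (simp add: \<sigma>_def field_simps)
    have l0: "0 < l" using E B by (simp add: l_def)
    have "E \<le> 1" using R1 by (simp add: E_def)
    then have l1: "l \<le> 1" using B E by (simp add: l_def field_simps)
    have q1: "1 \<le> q" by (simp add: q_def)
    have qe: "q\<^sup>2 = exp 1" by (simp add: q_def power2_eq_square flip: exp_add)
    have q2: "5 / 2 \<le> q\<^sup>2" unfolding qe using exp_lower_Taylor_quadratic[of 1] by simp
    have uk: "0 < u k" "u k \<le> B * E" "E / B \<le> u k" "u k \<le> 1" "(u k)\<^sup>2 \<le> 1 / R" if "k \<le> m" for k
    proof -
      have 1: "1 / B < u k / E" "u k / E < B" using u[OF that] E by auto
      then show 2: "u k \<le> B * E" "E / B \<le> u k" using E B by (auto simp: field_simps)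
      then show 3: "0 < u k" using E B divide_pos_pos[of E B] by linarith
      have "(u k)\<^sup>2 \<le> (B * E)\<^sup>2" using 2 3 by (intro power_mono) auto
      also have "\<dots> \<le> 1 / (3 * R)" using BE by (simp add: power_mult_distrib)
      also have "\<dots> \<le> 1 / R" using R1 by (simp add: field_simps)
      finally show 4: "(u k)\<^sup>2 \<le> 1 / R" .
      have "1 / R \<le> 1" using R1 by simp
      then have "(u k)\<^sup>2 \<le> 1\<^sup>2" using 4 by simp
      then show "u k \<le> 1" by (rule power2_le_imp_le) simp
    qed
    have sh: "l \<le> sinh (u k / 2)" "2 * sinh (u k / 2) \<le> S" "0 \<le> sinh (u k / 2)" if "k \<le> m" for k
    proof -
      define r where "r = E / B"
      have lS: "l = r / 2" "S = 3 * (B * E)" by (simp_all add: l_def r_def S_def)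
      have uu: "0 < u k" "u k \<le> B * E" "r \<le> u k" "u k \<le> 1" using uk[OF that] by (auto simp: r_def)
      have ss: "u k / 2 \<le> sinh (u k / 2)" "sinh (u k / 2) \<le> 3 / 2 * u k"
        using uu by (intro sinh_half_bounds; simp)+
      show "l \<le> sinh (u k / 2)" "2 * sinh (u k / 2) \<le> S" "0 \<le> sinh (u k / 2)"
        unfolding lS using uu ss by linarith+
    qed
    have ch: "1 \<le> cosh (u k / 2)" "(1 + 1 / R) * cosh (u k / 2) \<le> 1 + \<sigma>" if "k \<le> m" for k
    proof -
      show "1 \<le> cosh (u k / 2)" by (rule cosh_real_ge_1)
      have "cosh (u k / 2) \<le> 1 + 1 / R" using cosh_half_le[of "u k"] uk[OF that] by linarith
      then have "(1 + 1 / R) * cosh (u k / 2) \<le> (1 + 1 / R) * (1 + 1 / R)" using R1 by (intro mult_left_mono) auto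
      also have "\<dots> = 1 + 2 / R + 1 / R * (1 / R)" by (simp add: algebra_simps)
      also have "\<dots> \<le> 1 + 2 / R + 1 / R * 1" using R1 by (intro add_left_mono mult_left_mono) auto
      finally show "(1 + 1 / R) * cosh (u k / 2) \<le> 1 + \<sigma>" by (simp add: \<sigma>_def)
    qed
    define w where "w k = (if k = 0 then 0 else 1 :: real)" for k :: nat
    define P P2 where "P k = rstep 1 1 (w k) (u k)" and "P2 k = rstep (1 + 1 / R) 2 (w k) (u k)" for k
    have P_nn: "0 \<le> P k $ i $ j" and P_le: "P k $ i $ j \<le> P2 k $ i $ j" if "k \<le> m" for k i j
    proof -
      have "\<forall>i j. 0 \<le> P k $ i $ j \<and> P k $ i $ j \<le> P2 k $ i $ j"
        unfolding forall_2 P_def P2_def rstep_nth using sh[OF that] ch[OF that] R1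
        by (auto intro!: mult_left_mono simp: field_simps)
      then show "0 \<le> P k $ i $ j" "P k $ i $ j \<le> P2 k $ i $ j" by auto
    qed
    \<comment> \<open>The perturbation lemma with \<open>t = 0\<close> identifies the complex
      product with the real one.\<close>
    have MP: "M $ i $ j = of_real (mchain P m $ i $ j)" for i j
    proof -
      have "cmod (frame_product (\<lambda>_. 1) (\<lambda>k. of_real (u k)) m $ i $ j - of_real (mchain P m $ i $ j))
        \<le> 0 * (mchain P m $ i $ j - mchain P m $ i $ j)"
        unfolding frame_product_def
      proof (rule mchain_perturb(3))
        show "cmod ((Tr (if k = 0 then 0 else 1) ** Nm (of_real (u k))) $ i $ j - of_real (P k $ i $ j))
          \<le> 0 * (P k $ i $ j - P k $ i $ j)" for k i j
          using Tr_Nm_of_real[of "w k" "u k" i j] by (simp add: P_def w_def split: if_splits)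
      qed (use P_nn in auto)
      then show ?thesis unfolding M by simp
    qed
    have pert: "0 \<le> mchain P m $ i $ j" "mchain P m $ i $ j \<le> mchain P2 m $ i $ j"
      "cmod (M' $ i $ j - of_real (mchain P m $ i $ j)) \<le> 11 * \<epsilon> * (mchain P2 m $ i $ j - mchain P m $ i $ j)" for i j
    proof -
      have st: "cmod ((Tr (if k = 0 then 0 else v' k) ** Nm (u' k)) $ i $ j - of_real (P k $ i $ j))
          \<le> 11 * \<epsilon> * (P2 k $ i $ j - P k $ i $ j)" if k: "k \<le> m" for k i j
        unfolding P_def P2_def
        by (rule step_perturb) (use uk[OF k] R1 \<epsilon> u[OF k] v[of k] k in \<open>auto simp: w_def\<close>)
      have e: "0 \<le> 11 * \<epsilon>" "11 * \<epsilon> \<le> 1" using \<epsilon> by auto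
      show "0 \<le> mchain P m $ i $ j" "mchain P m $ i $ j \<le> mchain P2 m $ i $ j"
      "cmod (M' $ i $ j - of_real (mchain P m $ i $ j)) \<le> 11 * \<epsilon> * (mchain P2 m $ i $ j - mchain P m $ i $ j)"
        unfolding M' frame_product_def by (rule mchain_perturb[OF e P_nn P_le st]; assumption)+
    qed
    have qi: "exp (- (1 / 2)) = 1 / q" by (simp add: q_def exp_minus field_simps)
    have low: "q ^ m \<le> mchain P m $ 1 $ 1" "l * q ^ m \<le> mchain P m $ 1 $ 2" "l * q ^ m \<le> mchain P m $ 2 $ 1"
      "1 / q ^ m \<le> mchain P m $ 2 $ 2" "l\<^sup>2 * q ^ m \<le> mchain P m $ 2 $ 2"
    proof -
      have "q \<le> P k $ 1 $ 1 \<and> l * q \<le> P k $ 1 $ 2 \<and> 0 \<le> P k $ 2 $ 1 \<and> 1 / q \<le> P k $ 2 $ 2"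
        if "0 < k" "k \<le> m" for k
        using sh[OF that(2)] ch(1)[OF that(2)] that q1 P_nn[OF that(2)]
        by (auto simp: P_def w_def q_def[symmetric] qi field_simps)
      moreover have "1 \<le> P 0 $ 1 $ 1" "l \<le> P 0 $ 1 $ 2" "l \<le> P 0 $ 2 $ 1" "1 \<le> P 0 $ 2 $ 2"
        using sh[of 0] by (auto simp: P_def w_def cosh_real_ge_1)
      ultimately show "q ^ m \<le> mchain P m $ 1 $ 1" "l * q ^ m \<le> mchain P m $ 1 $ 2" "l * q ^ m \<le> mchain P m $ 2 $ 1"
      "1 / q ^ m \<le> mchain P m $ 2 $ 2" "l\<^sup>2 * q ^ m \<le> mchain P m $ 2 $ 2"
        using mchain_lower[of q l P m] q1 l0 l1 by auto
    qed
    define T where "T = (1 + 4 * \<sigma>) ^ m"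
    have up: "mchain P2 m $ 1 $ 1 \<le> 2 * T * q ^ m" "mchain P2 m $ 1 $ 2 \<le> 4 * T * S * q ^ m"
      "mchain P2 m $ 2 $ 1 \<le> 4 * T * S * q ^ m" "mchain P2 m $ 2 $ 2 \<le> 2 * T * (1 / q ^ m + 4 * S\<^sup>2 * q ^ m)"
    proof -
      have a: "P2 k $ 1 $ 1 \<le> q * (1 + \<sigma>) \<and> P2 k $ 1 $ 2 \<le> q * S \<and> P2 k $ 2 $ 1 \<le> S / q \<and> P2 k $ 2 $ 2 \<le> (1 + \<sigma>) / q"
        if "0 < k" "k \<le> m" for k
        using mult_left_mono[OF ch(2)[OF that(2)], of q] mult_left_mono[OF sh(2)[OF that(2)], of q]
          mult_left_mono[OF ch(2)[OF that(2)], of "1 / q"] mult_left_mono[OF sh(2)[OF that(2)], of "1 / q"] that q1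
        by (simp add: P2_def w_def q_def[symmetric] qi)
      have b: "P2 0 $ 1 $ 1 \<le> 1 + \<sigma>" "P2 0 $ 1 $ 2 \<le> S" "P2 0 $ 2 $ 1 \<le> S" "P2 0 $ 2 $ 2 \<le> 1 + \<sigma>"
        using sh[of 0] ch[of 0] by (auto simp: P2_def w_def)
      have c: "0 \<le> P2 k $ i $ j" if "k \<le> m" for k i j using P_nn[OF that, of i j] P_le[OF that, of i j] by linarith
      show "mchain P2 m $ 1 $ 1 \<le> 2 * T * q ^ m" "mchain P2 m $ 1 $ 2 \<le> 4 * T * S * q ^ m"
      "mchain P2 m $ 2 $ 1 \<le> 4 * T * S * q ^ m" "mchain P2 m $ 2 $ 2 \<le> 2 * T * (1 / q ^ m + 4 * S\<^sup>2 * q ^ m)"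
        unfolding T_def by (rule mchain_upper[where P = P2 and m = m, OF q1 q2 S0 S2 \<sigma> c b a]; assumption)+
    qed
    \<comment> \<open>Both off-diagonal entries are at least \<open>l * q ^ m\<close>, so their
      product is at least \<open>exp (real m - R) / (4 * B\<^sup>2)\<close>.\<close>
    have mR: "real m \<le> R + ln Z"
    proof -
      have "(l * q ^ m) * (l * q ^ m) \<le> mchain P m $ 1 $ 2 * mchain P m $ 2 $ 1"
        using low l0 q1 by (intro mult_mono) (auto intro: order_trans[of 0 "l * q ^ m"])
      also have "\<dots> \<le> C" using bc pert(1) by (simp add: MP)
      also have "(l * q ^ m) * (l * q ^ m) = l\<^sup>2 * (q\<^sup>2) ^ m" by (simp add: power2_eq_square power_mult_distrib)
      also have "\<dots> = exp (real m - R) / (4 * B\<^sup>2)"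
        by (simp add: l_def power_divide power_mult_distrib E2 qe exp_diff exp_minus field_simps flip: exp_of_nat_mult)
      finally have "exp (real m - R) \<le> 4 * B\<^sup>2 * C" using B by (simp add: field_simps)
      also have "\<dots> \<le> exp (ln Z)" using Z by (simp add: Z_def)
      finally show ?thesis by simp
    qed
    have T\<Theta>: "T \<le> \<Theta>"
    proof -
      have s0: "0 \<le> \<sigma>" using R1 by (simp add: \<sigma>_def)
      have "T \<le> exp (4 * \<sigma>) ^ m" unfolding T_def using exp_ge_add_one_self[of "4 * \<sigma>"] s0 by (intro power_mono) auto
      also have "\<dots> = exp (12 * (real m / R))" by (simp add: \<sigma>_def flip: exp_of_nat_mult)
      also have "\<dots> \<le> \<Theta>"
      proof -
        have "real m / R \<le> (R + ln Z) / R" using mR R1 by (intro divide_right_mono) auto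
        also have "\<dots> = 1 + ln Z / R" using R1 by (simp add: field_simps)
        also have "\<dots> \<le> 1 + ln Z" using R1 Z mult_left_mono[of 1 R "ln Z"] by (simp add: divide_le_eq)
        finally show ?thesis by (simp add: \<Theta>_def)
      qed
      finally show ?thesis .
    qed
    have "0 \<le> \<sigma>" using R1 by (simp add: \<sigma>_def)
    then have T0: "0 \<le> T" by (simp add: T_def)
    have \<Theta>0: "0 < \<Theta>" by (simp add: \<Theta>_def)
    have "2 * T * 1 \<le> 2 * \<Theta> * (1 + 4 * \<kappa>\<^sup>2)"
      using T\<Theta> T0 \<Theta>0 by (intro mult_mono) auto
    then have K1: "2 * T \<le> K" by (simp add: K_def)
    have K2: "4 * T * \<kappa> \<le> K"
    proof -
      have "\<kappa> * 1 \<le> \<kappa> * \<kappa>" using \<kappa> by (intro mult_left_mono) auto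
      then have "2 * \<kappa> \<le> 1 + 4 * \<kappa>\<^sup>2" unfolding power2_eq_square using \<kappa> by linarith
      then have "2 * T * (2 * \<kappa>) \<le> 2 * \<Theta> * (1 + 4 * \<kappa>\<^sup>2)"
        using T\<Theta> T0 \<kappa> by (intro mult_mono) auto
      then show ?thesis unfolding K_def by simp
    qed
    have 11: "mchain P2 m $ 1 $ 1 \<le> K * mchain P m $ 1 $ 1"
      using up(1) mult_mono[OF K1 low(1)] K0 q1 by simp
    have off: "4 * T * S * q ^ m \<le> K * y" if "l * q ^ m \<le> y" for y
      using mult_mono[OF K2 that] K0 q1 l0 by (simp add: Sl mult_ac)
    \<comment> \<open>Either summand of the upper bound may dominate, so each is compared with its
      own lower bound; this produces the factor \<open>1 + 4 * \<kappa>\<^sup>2\<close> in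
      \<open>K\<close>.\<close>
    have 22: "mchain P2 m $ 2 $ 2 \<le> K * mchain P m $ 2 $ 2"
    proof -
      have "4 * S\<^sup>2 * q ^ m = 4 * \<kappa>\<^sup>2 * (l\<^sup>2 * q ^ m)" by (simp add: Sl power_mult_distrib)
      also have "\<dots> \<le> 4 * \<kappa>\<^sup>2 * mchain P m $ 2 $ 2" using low(5) by (intro mult_left_mono) auto
      finally have "1 / q ^ m + 4 * S\<^sup>2 * q ^ m \<le> (1 + 4 * \<kappa>\<^sup>2) * mchain P m $ 2 $ 2"
        using low(4) by (simp add: algebra_simps)
      then have "2 * T * (1 / q ^ m + 4 * S\<^sup>2 * q ^ m) \<le> 2 * \<Theta> * ((1 + 4 * \<kappa>\<^sup>2) * mchain P m $ 2 $ 2)"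
        using T\<Theta> T0 q1 by (intro mult_mono) auto
      then show ?thesis using up(4) by (simp add: K_def)
    qed
    have "\<forall>i j. mchain P2 m $ i $ j \<le> K * mchain P m $ i $ j"
      unfolding forall_2 using 11 22 up(2,3) off[OF low(2)] off[OF low(3)] by auto
    then have P2K: "mchain P2 m $ i $ j \<le> K * mchain P m $ i $ j" by blast
    have "cmod (M' $ i $ j - M $ i $ j) \<le> 11 * \<epsilon> * (mchain P2 m $ i $ j - mchain P m $ i $ j)"
      using pert(3) by (simp add: MP)
    also have "\<dots> \<le> 11 * \<epsilon> * (K * mchain P m $ i $ j)"
      using P2K pert(1)[of i j] \<epsilon> by (intro mult_left_mono) auto
    also have "mchain P m $ i $ j = cmod (M $ i $ j)" using pert(1)[of i j] by (simp add: MP)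
    finally show ?thesis by (simp add: mult_ac)
  qed
  show ?thesis by (rule that[of "11 * K"]) (use K0 in simp, rule main, assumption+, rule refl, rule refl, assumption)
qed

subsection \<open>Frames\<close>

lemma Tr_in_sl2: "Tr z \<in> sl2"
  by (simp add: sl2_iff Tr_def flip: exp_add)

lemma Nm_in_sl2: "Nm z \<in> sl2"
  using hyperbolic_pythagoras[of "z / 2"] by (simp add: sl2_iff Nm_def power2_eq_square)

lemma Tr_0: "Tr 0 = mat 1"
  by (simp add: Tr_def mat2_eq_iff)

lemma frame_product_in_sl2: "frame_product v u m \<in> sl2"
  unfolding frame_product_def by (induction m) (auto intro: mult_in_sl2 Tr_in_sl2 Nm_in_sl2)

text \<open>The entries are real and nonnegative with positive diagonal, a property stable under
  products. This supplies the nonzero upper left entry that \<open>gdist_norm_bound\<close> asks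
  for; the inverse has the other diagonal entry there, so both are covered.\<close>

lemma frame_product_diag_nonzero:
  assumes "\<And>k. k \<le> m \<Longrightarrow> 0 < u k"
  shows "frame_product (\<lambda>_. 1) (\<lambda>k. of_real (u k)) m $ i $ i \<noteq> 0"
proof -
  define w where "w k = (if k = 0 then 0 else 1 :: real)" for k :: nat
  have fp: "frame_product (\<lambda>_. 1) (\<lambda>k. of_real (u k)) = mchain (\<lambda>k. Tr (of_real (w k)) ** Nm (of_real (u k)))"
    unfolding frame_product_def w_def by (intro arg_cong[where f = mchain]) auto
  have "k \<le> m \<Longrightarrow> \<exists>r. (\<forall>i j. mchain (\<lambda>k. Tr (of_real (w k)) ** Nm (of_real (u k))) k $ i $ j = of_real (r i j) \<and> 0 \<le> r i j)
      \<and> (\<forall>i. 0 < r i i)" for k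
  proof (induction k)
    case 0
    have "\<forall>i j. 0 \<le> rstep 1 1 (w 0) (u 0) $ i $ j" "\<forall>i. 0 < rstep 1 1 (w 0) (u 0) $ i $ i"
      unfolding forall_2 using assms[of 0] by auto
    then show ?case by (intro exI[of _ "\<lambda>i j. rstep 1 1 (w 0) (u 0) $ i $ j"]) (auto simp: Tr_Nm_of_real)
  next
    case (Suc k)
    then obtain r where r: "\<And>i j. mchain (\<lambda>k. Tr (of_real (w k)) ** Nm (of_real (u k))) k $ i $ j = of_real (r i j)"
      "\<And>i j. 0 \<le> r i j" "\<And>i. 0 < r i i" by auto
    define s where "s i j = rstep 1 1 (w (Suc k)) (u (Suc k)) $ i $ j" for i j
    have "\<forall>i j. 0 \<le> s i j" "\<forall>i. 0 < s i i"
      unfolding forall_2 s_def using assms[of "Suc k"] Suc.prems by auto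
    then have s: "0 \<le> s i j" "0 < s i i" for i j by auto
    have rs: "0 < r 1 1 * s 1 1" "0 < r 2 2 * s 2 2" "0 \<le> r i j * s k l" for i j k l
      using r s by (auto intro: mult_pos_pos mult_nonneg_nonneg)
    have "\<forall>i. 0 < r i 1 * s 1 i + r i 2 * s 2 i"
      unfolding forall_2 using rs by (auto intro: add_pos_nonneg add_nonneg_pos)
    then show ?case using r s
      by (intro exI[of _ "\<lambda>i j. r i 1 * s 1 j + r i 2 * s 2 j"])
         (auto simp: mat2_mult_nth[of "mchain _ _"] Tr_Nm_of_real simp flip: s_def)
  qed
  from this[of m] obtain r where
    "\<And>i j. mchain (\<lambda>k. Tr (of_real (w k)) ** Nm (of_real (u k))) m $ i $ j = of_real (r i j)" "\<And>i. 0 < r i i"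
    by auto
  from this(1)[of i i] this(2)[of i] show ?thesis by (simp add: fp)
qed

lemma Fr_in_sl2: "A \<in> Fr g \<Longrightarrow> A \<in> sl2"
  by (simp add: Fr_def sl2_def)

text \<open>A motion along the axis, parametrised by the diagonal entry rather than by a complex
  length as in \<open>Tr\<close>; this avoids choosing a logarithm.\<close>

definition dmat :: "complex \<Rightarrow> mat2" where
  "dmat \<alpha> = mk2 \<alpha> 0 0 (inverse \<alpha>)"

lemma dmat_in_sl2: "\<alpha> \<noteq> 0 \<Longrightarrow> dmat \<alpha> \<in> sl2"
  by (simp add: dmat_def sl2_iff)

text \<open>The matrix \<open>minv A ** x\<close> fixes 0 and infinity, hence is diagonal.
  Cross-multiplying the equal endpoint values also handles an endpoint at infinity.\<close>

lemma Fr_eq_mult_dmat: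
  assumes "x \<in> Fr g" "A \<in> Fr g"
  obtains \<alpha> where "\<alpha> \<noteq> 0" "x = A ** dmat \<alpha>"
proof -
  define D where "D = minv A ** x"
  have xA: "x \<in> sl2" "A \<in> sl2" using assms Fr_in_sl2 by auto
  have "mob A (Some 0) = mob x (Some 0)" "mob A None = mob x None" using assms by (auto simp: Fr_def)
  then have "A$1$2 * x$2$2 = x$1$2 * A$2$2" "A$1$1 * x$2$1 = x$1$1 * A$2$1"
    by (auto simp: mob_def field_simps split: if_splits)
  then have D0: "D$1$2 = 0" "D$2$1 = 0" by (simp_all add: D_def mat2_mult_nth mult.commute)
  have "D \<in> sl2" unfolding D_def using xA by (intro mult_in_sl2 minv_in_sl2)
  then have D1: "D$1$1 * D$2$2 = 1" using D0 by (simp add: sl2_iff)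
  then have "D$1$1 \<noteq> 0" by auto
  moreover have "D$2$2 = inverse (D$1$1)" using D1 by (simp add: inverse_unique)
  then have "D = dmat (D$1$1)" using D0 by (simp add: dmat_def mat2_eq_iff)
  moreover have "x = A ** D" by (simp add: D_def matrix_mul_assoc minv_right[OF xA(2)])
  ultimately show ?thesis using that[of "D$1$1"] by simp
qed

lemma frame_chain_eq_frame_product:
  assumes "frame_chain \<gamma> n A u v" "k < n"
  shows "A k ** Nm (u k) = A 0 ** frame_product v u k"
  unfolding frame_product_def using assms(2)
proof (induction k)
  case 0
  then show ?case by (simp add: Tr_0)
next
  case (Suc k)
  have "A (Suc k) = A k ** Nm (u k) ** Tr (v (Suc k))"
    using assms(1) Suc.prems unfolding frame_chain_def by (auto dest!: spec[of _ "Suc k"])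
  then show ?case using Suc by (simp add: matrix_mul_assoc)
qed

text \<open>\<open>e_map\<close> tests for the first geodesic, so frames on the last one must not
  lie on it. The strict cyclic order already separates the negative endpoints.\<close>

lemma linear_seq_Fr_disjoint:
  assumes "linear_seq \<gamma> n" "1 \<le> n" "x \<in> Fr (emb_geod (\<gamma> n))"
  shows "x \<notin> Fr (emb_geod (\<gamma> 0))"
proof
  assume "x \<in> Fr (emb_geod (\<gamma> 0))"
  then have "map_option complex_of_real (fst (\<gamma> 0)) = map_option complex_of_real (fst (\<gamma> n))"
    using assms(3) by (auto simp: Fr_def emb_geod_def)
  then have "fst (\<gamma> 0) = fst (\<gamma> n)" by (cases "fst (\<gamma> 0)"; cases "fst (\<gamma> n)") auto
  moreover have "geod_left (\<gamma> 0) (\<gamma> n)" using assms by (auto simp: linear_seq_def)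
  ultimately show False by (auto simp: geod_left_def cyc_def split: option.splits)
qed

lemma minv_mult_left_cancel:
  assumes "E \<in> sl2"
  shows "minv (E ** x) ** (E ** y) = minv x ** y"
proof -
  have "minv (E ** x) ** (E ** y) = minv x ** (minv E ** E) ** y" by (simp add: minv_mult matrix_mul_assoc)
  then show ?thesis by (simp add: minv_left[OF assms])
qed

lemma norm_diff_le_rel_error:
  fixes g g' :: mat2
  assumes "norm g \<le> C" "0 \<le> c" "\<And>i j. cmod (g' $ i $ j - g $ i $ j) \<le> c * cmod (g $ i $ j)"
  shows "norm (g' - g) \<le> 4 * c * C"
proof -
  have "cmod ((g' - g) $ i $ j) \<le> c * C" for i j
    using assms(3)[of i j] mult_left_mono[OF order_trans[OF norm_mat2_nth_le assms(1)] assms(2), of i j] by simp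
  from this[of 1 1] this[of 1 2] this[of 2 1] this[of 2 2] norm_mat2_le[of "g' - g"]
  show ?thesis by linarith
qed

lemma dmat_conj_nth:
  "(minv (dmat \<alpha>) ** (M ** dmat \<mu>)) $ 1 $ 1 = inverse \<alpha> * \<mu> * M $ 1 $ 1"
  "(minv (dmat \<alpha>) ** (M ** dmat \<mu>)) $ 1 $ 2 = inverse \<alpha> * inverse \<mu> * M $ 1 $ 2"
  "(minv (dmat \<alpha>) ** (M ** dmat \<mu>)) $ 2 $ 1 = \<alpha> * \<mu> * M $ 2 $ 1"
  "(minv (dmat \<alpha>) ** (M ** dmat \<mu>)) $ 2 $ 2 = \<alpha> * inverse \<mu> * M $ 2 $ 2"
  by (simp_all add: dmat_def mat2_mult_nth)

text \<open>Diagonal matrices on both sides multiply each entry of \<open>M\<close> and of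
  \<open>M'\<close> by the same scalar, so entrywise relative errors survive however large the
  scalars are.\<close>

lemma dmat_conj_rel_error:
  assumes "\<And>i j. cmod (M' $ i $ j - M $ i $ j) \<le> c * cmod (M $ i $ j)"
  shows "cmod ((minv (dmat \<alpha>) ** (M' ** dmat \<mu>)) $ i $ j - (minv (dmat \<alpha>) ** (M ** dmat \<mu>)) $ i $ j)
    \<le> c * cmod ((minv (dmat \<alpha>) ** (M ** dmat \<mu>)) $ i $ j)"
proof -
  have "cmod (s * M' $ i $ j - s * M $ i $ j) \<le> c * cmod (s * M $ i $ j)" for s i j
    using mult_left_mono[OF assms[of i j], of "cmod s"]
    by (simp add: norm_mult mult_ac flip: right_diff_distrib)
  then have "\<forall>i j. cmod ((minv (dmat \<alpha>) ** (M' ** dmat \<mu>)) $ i $ j - (minv (dmat \<alpha>) ** (M ** dmat \<mu>)) $ i $ j)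
    \<le> c * cmod ((minv (dmat \<alpha>) ** (M ** dmat \<mu>)) $ i $ j)"
    unfolding forall_2 dmat_conj_nth by blast
  then show ?thesis by blast
qed

lemma minv_rel_error:
  assumes "\<And>i j. cmod (g' $ i $ j - g $ i $ j) \<le> c * cmod (g $ i $ j)"
  shows "cmod (minv g' $ i $ j - minv g $ i $ j) \<le> c * cmod (minv g $ i $ j)"
proof -
  have "\<forall>i j. cmod (minv g' $ i $ j - minv g $ i $ j) \<le> c * cmod (minv g $ i $ j)"
    unfolding forall_2 minv_nth using assms by (simp add: norm_minus_commute)
  then show ?thesis by blast
qed

section \<open>Distortion of \<open>e_map\<close> on the two end geodesics\<close>

theorem theoremA14:
  fixes Q :: "complex^2^2 \<Rightarrow> complex^2^2 \<Rightarrow> real"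
  assumes "lie_inner Q"
  shows "\<forall>B>0. \<forall>D>0. \<exists>K>0. \<exists>\<epsilon>0>0. \<exists>R0>0. \<forall>R>R0. \<forall>\<epsilon><\<epsilon>0.
    \<forall>(n::nat) (\<gamma>::nat \<Rightarrow> geod2) (\<gamma>'::nat \<Rightarrow> geod3) (A::nat \<Rightarrow> mat2) (u::nat \<Rightarrow> real) (v::nat \<Rightarrow> real)
      (A'::nat \<Rightarrow> mat2) (u'::nat \<Rightarrow> complex) (v'::nat \<Rightarrow> complex).
      1 \<le> n \<and> linear_seq \<gamma> n \<and> semi_linear_seq \<gamma>' n \<and>
      frame_chain (\<lambda>i. emb_geod (\<gamma> i)) n A (\<lambda>i. complex_of_real (u i)) (\<lambda>i. complex_of_real (v i)) \<and>
      frame_chain \<gamma>' n A' u' v' \<and>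
      well_matched R B \<epsilon> n u v u' v'
      \<longrightarrow> bounded_distortion Q (K * \<epsilon>) D (Fr (emb_geod (\<gamma> 0)) \<union> Fr (emb_geod (\<gamma> n)))
            (e_map (emb_geod (\<gamma> 0)) (A 0) (A' 0)
               (A (n - 1) ** Nm (complex_of_real (u (n - 1)))) (A' (n - 1) ** Nm (u' (n - 1))))"
proof (intro allI impI)
  fix B D :: real
  assume BD: "0 < B" "0 < D"
  \<comment> \<open>The chain estimate is stated for constants at least 1; enlarging
    \<open>B\<close> only weakens the matching condition.\<close>
  define B1 where "B1 = max B 1"
  have B1: "1 \<le> B1" "B \<le> B1" by (auto simp: B1_def)
  obtain C where C: "C > 0"
    "\<And>g. g \<in> sl2 \<Longrightarrow> g$1$1 \<noteq> 0 \<Longrightarrow> gdist Q (mat 1) g < D \<Longrightarrow> norm g \<le> C"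
    using gdist_norm_bound[OF assms, where D = D] by blast
  have CC: "0 < C * C" using C by simp
  obtain K1 where K1: "K1 > 0"
    "\<And>R \<epsilon> m u u' v' i j. \<lbrakk>30 + 6 * B1\<^sup>2 < R; 0 < \<epsilon>; \<epsilon> \<le> 1 / 11;
       \<And>k. k \<le> m \<Longrightarrow> 1 / B1 < u k * exp (R / 2) \<and> u k * exp (R / 2) < B1 \<and> cmod (u' k - of_real (u k)) \<le> \<epsilon> * u k;
       \<And>k. 0 < k \<Longrightarrow> k \<le> m \<Longrightarrow> cmod (v' k - 1) \<le> \<epsilon> / R;
       cmod (frame_product (\<lambda>_. 1) (\<lambda>k. of_real (u k)) m $ 1 $ 2) *
       cmod (frame_product (\<lambda>_. 1) (\<lambda>k. of_real (u k)) m $ 2 $ 1) \<le> C * C\<rbrakk> \<Longrightarrow>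
       cmod (frame_product v' u' m $ i $ j
         - frame_product (\<lambda>_. 1) (\<lambda>k. of_real (u k)) m $ i $ j)
       \<le> K1 * \<epsilon> * cmod (frame_product (\<lambda>_. 1) (\<lambda>k. of_real (u k)) m $ i $ j)"
    using frame_product_relative_error[OF B1(1) CC] by blast
  obtain K2 \<delta> where K2: "K2 > 0" "\<delta> > 0"
    "\<And>g h. g \<in> sl2 \<Longrightarrow> h \<in> sl2 \<Longrightarrow> norm g \<le> C \<Longrightarrow> norm (h - g) < \<delta> \<Longrightarrow> sl2_dist Q g h \<le> K2 * norm (h - g)"
    using sl2_dist_le_norm[OF assms C(1)] by blast
  define c where "c = 4 * K1 * C"
  have c: "c > 0" using K1 C by (simp add: c_def)
  \<comment> \<open>The summand 1 makes the final inequality strict. Below, \<open>e0\<close>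
    combines the smallness for a single step (1/11) with the radius \<delta> of the local distance
    estimate.\<close>
  define K where "K = K2 * c + 1"
  have K: "K > 0" using K2(1) c by (simp add: K_def add_pos_pos)
  define e0 where "e0 = min (1 / 11) (\<delta> / c)"
  have e0: "e0 > 0" using K2(2) c by (simp add: e0_def)
  define R0 where "R0 = 30 + 6 * B1\<^sup>2"
  have R0: "R0 > 0" unfolding R0_def by (intro add_pos_nonneg) auto
  have near: "gdist Q g g' < K * \<epsilon>"
    if g: "g \<in> sl2" "g' \<in> sl2" "norm g \<le> C" and \<epsilon>: "0 < \<epsilon>" "\<epsilon> < e0"
      and rel: "\<And>i j. cmod (g' $ i $ j - g $ i $ j) \<le> (K1 * \<epsilon>) * cmod (g $ i $ j)" for g g' \<epsilon>
  proof -
    have "norm (g' - g) \<le> 4 * (K1 * \<epsilon>) * C"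
      by (rule norm_diff_le_rel_error[OF g(3) _ rel]) (use K1(1) \<epsilon> in auto)
    then have n: "norm (g' - g) \<le> c * \<epsilon>" by (simp add: c_def mult_ac)
    have "\<epsilon> < \<delta> / c" using \<epsilon> by (simp add: e0_def)
    then have "c * \<epsilon> < \<delta>" using c by (simp add: field_simps)
    then have "sl2_dist Q g g' \<le> K2 * norm (g' - g)" using n by (intro K2(3) g) auto
    also have "\<dots> \<le> K2 * (c * \<epsilon>)" using n K2(1) by (intro mult_left_mono) auto
    also have "\<dots> < K * \<epsilon>" using \<epsilon> by (simp add: K_def algebra_simps)
    finally show ?thesis by (simp add: gdist_def)
  qed
  have same: "gdist Q g g < K * \<epsilon>" if "g \<in> sl2" "0 < \<epsilon>" for g \<epsilon>
    using sl2_dist_self_le[OF assms that(1)] mult_pos_pos[OF K that(2)] by (simp add: gdist_def)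
  show "\<exists>K>0. \<exists>\<epsilon>0>0. \<exists>R0>0. \<forall>R>R0. \<forall>\<epsilon><\<epsilon>0.
    \<forall>(n::nat) (\<gamma>::nat \<Rightarrow> geod2) (\<gamma>'::nat \<Rightarrow> geod3) (A::nat \<Rightarrow> mat2) (u::nat \<Rightarrow> real) (v::nat \<Rightarrow> real)
      (A'::nat \<Rightarrow> mat2) (u'::nat \<Rightarrow> complex) (v'::nat \<Rightarrow> complex).
      1 \<le> n \<and> linear_seq \<gamma> n \<and> semi_linear_seq \<gamma>' n \<and>
      frame_chain (\<lambda>i. emb_geod (\<gamma> i)) n A (\<lambda>i. complex_of_real (u i)) (\<lambda>i. complex_of_real (v i)) \<and>
      frame_chain \<gamma>' n A' u' v' \<and>
      well_matched R B \<epsilon> n u v u' v'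
      \<longrightarrow> bounded_distortion Q (K * \<epsilon>) D (Fr (emb_geod (\<gamma> 0)) \<union> Fr (emb_geod (\<gamma> n)))
            (e_map (emb_geod (\<gamma> 0)) (A 0) (A' 0)
               (A (n - 1) ** Nm (complex_of_real (u (n - 1)))) (A' (n - 1) ** Nm (u' (n - 1))))"
  proof (rule exI[of _ K], rule conjI[OF K], rule exI[of _ e0], rule conjI[OF e0],
      rule exI[of _ R0], rule conjI[OF R0], intro allI impI, elim conjE)
    fix R \<epsilon> :: real and n :: nat and \<gamma> :: "nat \<Rightarrow> geod2" and \<gamma>' :: "nat \<Rightarrow> geod3" and A :: "nat \<Rightarrow> mat2"
      and u v :: "nat \<Rightarrow> real" and A' :: "nat \<Rightarrow> mat2" and u' v' :: "nat \<Rightarrow> complex"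
    assume R: "R0 < R" and \<epsilon>: "\<epsilon> < e0" and n: "1 \<le> n" and lin: "linear_seq \<gamma> n"
      and fc: "frame_chain (\<lambda>i. emb_geod (\<gamma> i)) n A (\<lambda>i. complex_of_real (u i)) (\<lambda>i. complex_of_real (v i))"
      and fc': "frame_chain \<gamma>' n A' u' v'" and wm: "well_matched R B \<epsilon> n u v u' v'"
    define m where "m = n - 1"
    have m: "m < n" "n = Suc m" using n by (auto simp: m_def)
    have u: "1 / B < u k * exp (R / 2)" "u k * exp (R / 2) < B" "cmod (u' k - of_real (u k)) < \<epsilon> * \<bar>u k\<bar>"
      and v: "0 < k \<Longrightarrow> v k = 1" "0 < k \<Longrightarrow> cmod (v' k - 1) < \<epsilon> / R" if "k \<le> m" for k
      using wm that m by (auto simp: well_matched_def)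
    have u0: "0 < u k" if "k \<le> m" for k
    proof -
      have "0 < 1 / B" using BD by simp
      then have "0 < u k * exp (R / 2)" using u(1)[OF that] by linarith
      then show ?thesis by (simp add: zero_less_mult_iff)
    qed
    \<comment> \<open>Positivity of \<epsilon> is forced by the strict bound on \<open>u' 0\<close>,
      which exists because \<open>1 \<le> n\<close>.\<close>
    have \<epsilon>0: "0 < \<epsilon>"
    proof -
      have "0 < \<epsilon> * u 0" using le_less_trans[OF norm_ge_zero u(3)[of 0]] u0[of 0] by simp
      then show ?thesis using u0[of 0] by (simp add: zero_less_mult_iff)
    qed
    have uB: "1 / B1 < u k * exp (R / 2) \<and> u k * exp (R / 2) < B1 \<and> cmod (u' k - of_real (u k)) \<le> \<epsilon> * u k"
      if "k \<le> m" for k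
    proof -
      have "1 / B1 \<le> 1 / B" using BD B1 by (intro divide_left_mono) auto
      then show ?thesis using u[OF that] u0[OF that] B1 by auto
    qed
    define M where "M = frame_product (\<lambda>_. 1) (\<lambda>k. of_real (u k)) m"
    define M' where "M' = frame_product v' u' m"
    define F F' where "F = A (n - 1) ** Nm (complex_of_real (u (n - 1)))" and "F' = A' (n - 1) ** Nm (u' (n - 1))"
    have F: "F = A 0 ** M"
    proof -
      have "frame_product (\<lambda>k. of_real (v k)) (\<lambda>k. of_real (u k)) k
        = frame_product (\<lambda>_. 1) (\<lambda>k. of_real (u k)) k" if "k \<le> m" for k
        using that unfolding frame_product_def by (induction k) (auto simp: v)
      then show ?thesis using frame_chain_eq_frame_product[OF fc m(1)] unfolding F_def M_def m_def by simp
    qed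
    have F': "F' = A' 0 ** M'" using frame_chain_eq_frame_product[OF fc' m(1)] unfolding F'_def M'_def m_def by simp
    have MM: "M \<in> sl2" "M' \<in> sl2" unfolding M_def M'_def by (rule frame_product_in_sl2)+
    have Mii: "M $ i $ i \<noteq> 0" for i unfolding M_def by (rule frame_product_diag_nonzero[OF u0])
    have rel: "cmod (M' $ i $ j - M $ i $ j) \<le> K1 * \<epsilon> * cmod (M $ i $ j)"
      if "cmod (M $ 1 $ 2) * cmod (M $ 2 $ 1) \<le> C * C" for i j
      unfolding M_def M'_def
      by (rule K1(2)[of R]) (use R \<epsilon> \<epsilon>0 uB v that in \<open>auto simp: R0_def e0_def M_def less_imp_le\<close>)
    have cp: "common_perp (emb_geod (\<gamma> 0)) (emb_geod (\<gamma> (Suc 0))) (A 0) (of_real (u 0))"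
      "common_perp (\<gamma>' 0) (\<gamma>' (Suc 0)) (A' 0) (u' 0)"
      "common_perp (emb_geod (\<gamma> m)) (emb_geod (\<gamma> n)) (A m) (of_real (u m))"
      using fc fc' m by (auto simp: frame_chain_def)
    have A0: "A 0 \<in> Fr (emb_geod (\<gamma> 0))" "A 0 \<in> sl2" "A' 0 \<in> sl2" and Fn: "F \<in> Fr (emb_geod (\<gamma> n))" 
      using cp by (auto simp: common_perp_def F_def m_def intro: Fr_in_sl2)
    have Fsl: "F \<in> sl2" "F' \<in> sl2" unfolding F F' using A0 MM by (auto intro: mult_in_sl2)
    let ?e = "e_map (emb_geod (\<gamma> 0)) (A 0) (A' 0) F F'"
    have ex: "?e x = A' 0 ** minv (A 0) ** x" if "x \<in> Fr (emb_geod (\<gamma> 0))" for x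
      using that by (simp add: e_map_def)
    have ey: "?e y = F' ** minv F ** y" if "y \<in> Fr (emb_geod (\<gamma> n))" for y
      using linear_seq_Fr_disjoint[OF lin n that] by (simp add: e_map_def)
    have E0: "A' 0 ** minv (A 0) \<in> sl2" "F' ** minv F \<in> sl2"
      using A0 Fsl by (auto intro: mult_in_sl2 minv_in_sl2)
    \<comment> \<open>On each end geodesic \<open>e_map\<close> is a left multiplication and keeps
      the diagonal coordinate of a frame, so from \<open>minv x ** y\<close> to its image only
      \<open>M\<close> changes, to \<open>M'\<close>.\<close>
    have cross: "\<exists>\<alpha> \<mu>. \<alpha> \<noteq> 0 \<and> \<mu> \<noteq> 0 \<and> minv x ** y = minv (dmat \<alpha>) ** (M ** dmat \<mu>) \<and>
       minv (?e x) ** ?e y = minv (dmat \<alpha>) ** (M' ** dmat \<mu>)"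
      if x: "x \<in> Fr (emb_geod (\<gamma> 0))" and y: "y \<in> Fr (emb_geod (\<gamma> n))" for x y
    proof -
      obtain \<alpha> where \<alpha>: "\<alpha> \<noteq> 0" "x = A 0 ** dmat \<alpha>" using Fr_eq_mult_dmat[OF x A0(1)] by blast
      obtain \<mu> where \<mu>: "\<mu> \<noteq> 0" "y = F ** dmat \<mu>" using Fr_eq_mult_dmat[OF y Fn] by blast
      have "?e x = A' 0 ** (minv (A 0) ** A 0) ** dmat \<alpha>" using ex[OF x] by (simp only: \<alpha>(2) matrix_mul_assoc)
      then have e1: "?e x = A' 0 ** dmat \<alpha>" by (simp add: minv_left[OF A0(2)])
      have "?e y = F' ** (minv F ** F) ** dmat \<mu>" using ey[OF y] by (simp only: \<mu>(2) matrix_mul_assoc)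
      then have e2: "?e y = A' 0 ** (M' ** dmat \<mu>)" by (simp add: minv_left[OF Fsl(1)] F' matrix_mul_assoc)
      have "y = A 0 ** (M ** dmat \<mu>)" by (simp add: \<mu>(2) F matrix_mul_assoc)
      then have "minv x ** y = minv (dmat \<alpha>) ** (M ** dmat \<mu>)"
        using \<alpha>(2) minv_mult_left_cancel[OF A0(2)] by simp
      moreover have "minv (?e x) ** ?e y = minv (dmat \<alpha>) ** (M' ** dmat \<mu>)"
        unfolding e1 e2 by (rule minv_mult_left_cancel[OF A0(3)])
      ultimately show ?thesis using \<alpha>(1) \<mu>(1) by blast
    qed
    have conj_rel: "cmod (g' $ i $ j - g $ i $ j) \<le> (K1 * \<epsilon>) * cmod (g $ i $ j)"
      if "\<alpha> \<noteq> 0" "\<mu> \<noteq> 0" "g = minv (dmat \<alpha>) ** (M ** dmat \<mu>)" "g' = minv (dmat \<alpha>) ** (M' ** dmat \<mu>)"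
        "cmod (g $ 1 $ 2) \<le> C" "cmod (g $ 2 $ 1) \<le> C" for \<alpha> \<mu> g g' i j
    proof -
      \<comment> \<open>The scalars of the two off-diagonal entries are mutually inverse, so the
        bound on \<open>g\<close> passes to the product of off-diagonal entries of
        \<open>M\<close>.\<close>
      have "g $ 1 $ 2 * g $ 2 $ 1 = M $ 1 $ 2 * M $ 2 $ 1" using that(1,2) by (simp add: that(3) dmat_conj_nth field_simps)
      then have "cmod (M $ 1 $ 2) * cmod (M $ 2 $ 1) = cmod (g $ 1 $ 2) * cmod (g $ 2 $ 1)" by (metis norm_mult)
      also have "\<dots> \<le> C * C" using that C(1) by (intro mult_mono) auto
      finally show ?thesis unfolding that(3,4) by (intro dmat_conj_rel_error rel)
    qed
    have conj_sl2: "minv (dmat \<alpha>) ** (N ** dmat \<mu>) \<in> sl2" if "\<alpha> \<noteq> 0" "\<mu> \<noteq> 0" "N \<in> sl2" for \<alpha> \<mu> N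
      using that by (intro mult_in_sl2 minv_in_sl2 dmat_in_sl2)
    show "bounded_distortion Q (K * \<epsilon>) D (Fr (emb_geod (\<gamma> 0)) \<union> Fr (emb_geod (\<gamma> n)))
       (e_map (emb_geod (\<gamma> 0)) (A 0) (A' 0)
               (A (n - 1) ** Nm (complex_of_real (u (n - 1)))) (A' (n - 1) ** Nm (u' (n - 1))))"
      unfolding bounded_distortion_def F_def[symmetric] F'_def[symmetric]
    proof (intro ballI impI)
      fix x y
      assume "x \<in> Fr (emb_geod (\<gamma> 0)) \<union> Fr (emb_geod (\<gamma> n))" "y \<in> Fr (emb_geod (\<gamma> 0)) \<union> Fr (emb_geod (\<gamma> n))"
        and d: "gdist Q (mat 1) (minv x ** y) < D"
      then consider (first) "x \<in> Fr (emb_geod (\<gamma> 0))" "y \<in> Fr (emb_geod (\<gamma> 0))"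
        | (last) "x \<in> Fr (emb_geod (\<gamma> n))" "y \<in> Fr (emb_geod (\<gamma> n))"
        | (first_last) "x \<in> Fr (emb_geod (\<gamma> 0))" "y \<in> Fr (emb_geod (\<gamma> n))"
        | (last_first) "x \<in> Fr (emb_geod (\<gamma> n))" "y \<in> Fr (emb_geod (\<gamma> 0))" by blast
      then show "gdist Q (minv x ** y) (minv (?e x) ** ?e y) < K * \<epsilon>"
      proof cases
        \<comment> \<open>Two frames on one geodesic are moved by a single isometry, so their
          relative position is unchanged and only a distance from an element to itself
          remains.\<close>
        case first
        show ?thesis unfolding ex[OF first(1)] ex[OF first(2)] minv_mult_left_cancel[OF E0(1)]
          by (intro same mult_in_sl2 minv_in_sl2 \<epsilon>0 first[THEN Fr_in_sl2])
      next
        case last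
        show ?thesis unfolding ey[OF last(1)] ey[OF last(2)] minv_mult_left_cancel[OF E0(2)]
          by (intro same mult_in_sl2 minv_in_sl2 \<epsilon>0 last[THEN Fr_in_sl2])
      next
        case first_last
        obtain \<alpha> \<mu> where z: "\<alpha> \<noteq> 0" "\<mu> \<noteq> 0" and g: "minv x ** y = minv (dmat \<alpha>) ** (M ** dmat \<mu>)"
          "minv (?e x) ** ?e y = minv (dmat \<alpha>) ** (M' ** dmat \<mu>)" using cross[OF first_last] by blast
        have sl: "minv x ** y \<in> sl2" "minv (?e x) ** ?e y \<in> sl2" unfolding g using z MM by (auto intro: conj_sl2)
        have nC: "norm (minv x ** y) \<le> C"
          by (rule C(2)[OF sl(1) _ d]) (use Mii z in \<open>simp add: g dmat_conj_nth\<close>)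
        show ?thesis
          by (rule near[OF sl nC \<epsilon>0 \<epsilon> conj_rel[OF z g]]; rule order_trans[OF norm_mat2_nth_le nC])
      next
        \<comment> \<open>The reversed pair has the inverse matrix; \<open>minv\<close> permutes
          entries up to sign, so norm bounds and relative errors carry over.\<close>
        case last_first
        obtain \<alpha> \<mu> where z: "\<alpha> \<noteq> 0" "\<mu> \<noteq> 0" and g: "minv y ** x = minv (dmat \<alpha>) ** (M ** dmat \<mu>)"
          "minv (?e y) ** ?e x = minv (dmat \<alpha>) ** (M' ** dmat \<mu>)" using cross[OF last_first(2,1)] by blast
        define h h' where "h = minv y ** x" and "h' = minv (?e y) ** ?e x"
        have gh: "minv x ** y = minv h" "minv (?e x) ** ?e y = minv h'"
          by (simp_all add: h_def h'_def minv_mult minv_minv)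
        have sl: "minv h \<in> sl2" "minv h' \<in> sl2" unfolding h_def h'_def g using z MM by (auto intro: conj_sl2 minv_in_sl2)
        have nC: "norm (minv h) \<le> C"
          by (rule C(2)[OF sl(1)]) (use Mii z d in \<open>simp_all add: gh(1)\<close>, simp add: h_def g dmat_conj_nth)
        have hC: "cmod (h $ 1 $ 2) \<le> C" "cmod (h $ 2 $ 1) \<le> C"
          using order_trans[OF norm_mat2_nth_le nC, of 1 2] order_trans[OF norm_mat2_nth_le nC, of 2 1] by auto
        show ?thesis unfolding gh
          by (rule near[OF sl nC \<epsilon>0 \<epsilon> minv_rel_error], rule conj_rel[OF z])
             (simp_all add: h_def h'_def g hC[unfolded h_def g])
      qed
    qed
  qed
qed

end
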